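(* Let $(P_1,Q_1)\neq(P_2,Q_2)$ be non-degenerate integer pairs with $P_i>0$ and $|Q_i|=1$ ($i=1,2$), and let $D_i=P_i^2-4Q_i$. The intersection $\{V_n(P_1,Q_1):n\ge0\}\cap\{V_n(P_2,Q_2):n\ge0\}$ is infinite if and only if $D_1D_2$ is a perfect square. Moreover, in that case there exist integers $P'>0$ and $Q'$ with $|Q'|=1$ such that this intersection equals $\{V_n(P',Q'):n\ge0\}$.
   Context: For integers $P,Q$, the Lucas sequences are defined by $U_0(P,Q)=0$, $U_1(P,Q)=1$, $V_0(P,Q)=2$, $V_1(P,Q)=P$, and for $n\ge1$: $U_{n+1}=P\,U_n-Q\,U_{n-1}$, $V_{n+1}=P\,V_n-Q\,V_{n-1}$. The discriminant of $(P,Q)$ is $P^2-4Q$. A pair $(P,Q)$ (and its sequences) is called degenerate if $(P,Q)\in\{(0,1),(0,-1),(1,1),(2,1)\}$, and non-degenerate otherwise. *)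

theory Defs
  imports Main
begin

fun lucasU :: "int \<Rightarrow> int \<Rightarrow> nat \<Rightarrow> int" where
  "lucasU P Q 0 = 0"
| "lucasU P Q (Suc 0) = 1"
| "lucasU P Q (Suc (Suc n)) = P * lucasU P Q (Suc n) - Q * lucasU P Q n"

fun lucasV :: "int \<Rightarrow> int \<Rightarrow> nat \<Rightarrow> int" where
  "lucasV P Q 0 = 2"
| "lucasV P Q (Suc 0) = P"
| "lucasV P Q (Suc (Suc n)) = P * lucasV P Q (Suc n) - Q * lucasV P Q n"

definition lucas_disc :: "int \<Rightarrow> int \<Rightarrow> int" where
  "lucas_disc P Q = P^2 - 4 * Q"

definition degenerate :: "int \<Rightarrow> int \<Rightarrow> bool" where
  "degenerate P Q \<longleftrightarrow> (P, Q) \<in> {(0, 1), (0, -1), (1, 1), (2, 1)}"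

definition Vset :: "int \<Rightarrow> int \<Rightarrow> int set" where
  "Vset P Q = range (lucasV P Q)"

end

theory Submission
  imports Defs "HOL-Analysis.Generalised_Binomial_Theorem" "HOL-Computational_Algebra.Formal_Power_Series"
begin

text \<open>
  Let \<open>t\<close> lie in both sets. If the norms \<open>Q1 ^ n\<close> and \<open>Q2 ^ m\<close> agree, multiplying the two relations
  \<open>t\<^sup>2 - 4 Q ^ n = D u\<^sup>2\<close> exhibits \<open>D1 D2\<close> as a square. If they differ, \<open>t\<^sup>2 - 4\<close> and \<open>t\<^sup>2 + 4\<close> are
  \<open>D1 u\<^sup>2\<close> and \<open>D2 v\<^sup>2\<close> up to order, and there are only finitely many such \<open>t\<close>: a large solution \<open>b\<close>
  would make \<open>sqrt (1 - 4 / N)\<close> and \<open>sqrt (1 + 4 / N)\<close>, where \<open>N = b\<^sup>2\<close>, simultaneously approximable to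
  order \<open>1 / q\<^sup>2\<close> by fractions of a common denominator \<open>q\<close>, for every further solution \<open>q / b\<close>.
  Rickert's Pade approximants to \<open>1, sqrt (1 - s), sqrt (1 + s)\<close>, the residues of
  \<open>(1 + z s) powr (k + 1 / 2) / (\<Prod>l\<in>{- 1, 0, 1}. (z - l) ^ m l)\<close>, exclude this once \<open>N\<close> and \<open>q\<close> are
  large; since \<open>b\<close> may be chosen as large as we please, crude constants suffice.

  Conversely, if \<open>D1 D2\<close> is a square, both sequences live in one real quadratic field. By the
  pigeonhole principle the roots \<open>x, y > 1\<close> of the two characteristic polynomials satisfy
  \<open>x ^ a = y ^ b\<close>; for the least such \<open>a\<close>, the common terms are exactly the traces of powers of \<open>x ^ a\<close>.
\<close>

section \<open>Residues of rational functions\<close>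

abbreviation up :: "'a \<Rightarrow> ('a \<Rightarrow> nat) \<Rightarrow> 'a \<Rightarrow> nat" where
  "up i m \<equiv> m(i := Suc (m i))"

text \<open>The Taylor series of \<open>1 / (z - l)\<close> at \<open>z = c\<close>, with
  \<open>fps_X\<close> in the role of \<open>z - c\<close>.\<close>

definition inv_lin :: "real \<Rightarrow> real \<Rightarrow> real fps" where
  "inv_lin c l = inverse (fps_X + fps_const (c - l))"

definition cofactor :: "real set \<Rightarrow> (real \<Rightarrow> nat) \<Rightarrow> real \<Rightarrow> real fps" where
  "cofactor A m c = (\<Prod>l\<in>A - {c}. inv_lin c l ^ m l)"

text \<open>
  With \<open>H\<close> the Taylor series of \<open>F\<close> at \<open>c\<close>, this is the residue at \<open>c\<close> of \<open>F z / (\<Prod>l\<in>A. (z - l) ^ m l)\<close>.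
  The extra factor \<open>fps_X\<close> makes it 0 when \<open>m c = 0\<close>.
\<close>

definition residue_at :: "real set \<Rightarrow> real fps \<Rightarrow> (real \<Rightarrow> nat) \<Rightarrow> real \<Rightarrow> real" where
  "residue_at A H m c = fps_nth (fps_X * H * cofactor A m c) (m c)"

lemma inv_lin_cancel:
  assumes "c \<noteq> l"
  shows "(fps_X + fps_const (c - l)) * inv_lin c l = 1"
  unfolding inv_lin_def by (rule inverse_mult_eq_1') (use assms in simp)

lemma inv_lin_X:
  assumes "c \<noteq> l"
  shows "fps_X * inv_lin c l = 1 - fps_const (c - l) * inv_lin c l"
  using inv_lin_cancel[OF assms] by (simp add: algebra_simps)

lemma cofactor_up_same [simp]: "cofactor A (up c m) c = cofactor A m c"
  unfolding cofactor_def by (rule prod.cong) auto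

lemma cofactor_up:
  assumes "finite A" "i \<in> A" "i \<noteq> c"
  shows "cofactor A (up i m) c = inv_lin c i * cofactor A m c"
proof -
  have i: "i \<in> A - {c}" using assms by simp
  have "(\<Prod>l\<in>A - {c} - {i}. inv_lin c l ^ up i m l) = (\<Prod>l\<in>A - {c} - {i}. inv_lin c l ^ m l)"
    by (rule prod.cong) auto
  then show ?thesis
    unfolding cofactor_def using assms prod.remove[OF _ i, of "\<lambda>l. inv_lin c l ^ up i m l"]
      prod.remove[OF _ i, of "\<lambda>l. inv_lin c l ^ m l"] by (simp add: mult.assoc)
qed

lemma residue_at_up_same:
  "residue_at A H (up c m) c = fps_nth (H * cofactor A m c) (m c)"
  unfolding residue_at_def cofactor_up_same by (simp add: mult.assoc)

lemma residue_at_up: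
  assumes "finite A" "i \<in> A" "i \<noteq> c"
  shows "residue_at A H (up i m) c = fps_nth (fps_X * H * cofactor A m c * inv_lin c i) (m c)"
  unfolding residue_at_def cofactor_up[OF assms] using assms by (simp add: mult_ac)

text \<open>Partial fractions:
  \<open>(i - j) / ((z - i) * (z - j)) = 1 / (z - i) - 1 / (z - j)\<close>. The expansion point
  \<open>c\<close> may be \<open>i\<close>, \<open>j\<close> or neither.\<close>

lemma residue_at_diff:
  assumes "finite A" "i \<in> A" "j \<in> A" "i \<noteq> j"
  shows "(i - j) * residue_at A H (up i (up j m)) c
       = residue_at A H (up i m) c - residue_at A H (up j m) c"
proof -
  have same: "(c - j) * residue_at A H (up c (up j m)) c
       = residue_at A H (up c m) c - residue_at A H (up j m) c"
    if "j \<in> A" "c \<noteq> j" for j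
  proof -
    let ?G = "H * cofactor A m c"
    have "residue_at A H (up j m) c = fps_nth (?G * (fps_X * inv_lin c j)) (m c)"
      using that assms(1) by (simp add: residue_at_up mult_ac)
    also have "?G * (fps_X * inv_lin c j) = ?G - fps_const (c - j) * (?G * inv_lin c j)"
      unfolding inv_lin_X[OF that(2)] by (simp add: algebra_simps)
    also have "fps_nth \<dots> (m c) = fps_nth ?G (m c) - (c - j) * fps_nth (?G * inv_lin c j) (m c)"
      by simp
    finally have "residue_at A H (up j m) c =
        fps_nth ?G (m c) - (c - j) * fps_nth (?G * inv_lin c j) (m c)" .
    moreover have "residue_at A H (up c (up j m)) c = fps_nth (?G * inv_lin c j) (m c)"
      unfolding residue_at_up_same using that assms(1) by (simp add: cofactor_up mult_ac)
    ultimately show ?thesis by (simp add: residue_at_up_same)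
  qed
  consider "c = i" | "c = j" | "c \<noteq> i" "c \<noteq> j" by blast
  then show ?thesis
  proof cases
    case 1
    then show ?thesis using same[of j] assms by simp
  next
    case 2
    have "up i (up j m) = up j (up i m)" using assms by (simp add: fun_upd_twist)
    then show ?thesis using same[of i] assms 2 by (simp add: algebra_simps)
  next
    case 3
    let ?G = "fps_X * H * cofactor A m c"
    have Y: "fps_const (c - j) - fps_const (c - i) = fps_const (i - j)" by simp
    have "inv_lin c i - inv_lin c j
        = inv_lin c i * ((fps_X + fps_const (c - j)) * inv_lin c j)
          - inv_lin c j * ((fps_X + fps_const (c - i)) * inv_lin c i)"
      using 3 by (simp add: inv_lin_cancel)
    also have "\<dots> = (fps_const (c - j) - fps_const (c - i)) * (inv_lin c i * inv_lin c j)"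
      by (simp only: algebra_simps)
    finally have D: "inv_lin c i - inv_lin c j = fps_const (i - j) * (inv_lin c i * inv_lin c j)"
      unfolding Y .
    have "?G * inv_lin c i - ?G * inv_lin c j = ?G * (inv_lin c i - inv_lin c j)"
      by (simp only: right_diff_distrib)
    then have "?G * inv_lin c i - ?G * inv_lin c j
        = fps_const (i - j) * (?G * (inv_lin c i * inv_lin c j))"
      unfolding D by (simp only: mult_ac)
    then have "fps_nth (?G * inv_lin c i) (m c) - fps_nth (?G * inv_lin c j) (m c)
        = (i - j) * fps_nth (?G * (inv_lin c i * inv_lin c j)) (m c)"
      by (metis fps_mult_left_const_nth fps_sub_nth)
    moreover have "residue_at A H (up i (up j m)) c = fps_nth (?G * (inv_lin c i * inv_lin c j)) (m c)"
      using 3 assms by (simp add: residue_at_up cofactor_up mult_ac del: fun_upd_apply) (simp add: mult_ac)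
    ultimately show ?thesis using 3 assms by (simp add: residue_at_up)
  qed
qed

lemma residue_at_zero [simp]: "m c = 0 \<Longrightarrow> residue_at A H m c = 0"
  by (simp add: residue_at_def)

lemma residue_at_single:
  assumes "\<forall>l\<in>A - {c}. m l = 0" "m c = Suc n"
  shows "residue_at A H m c = fps_nth H n"
proof -
  have "cofactor A m c = 1" unfolding cofactor_def using assms by (intro prod.neutral) auto
  then show ?thesis by (simp add: residue_at_def assms)
qed

text \<open>In the local coordinate, \<open>fps_const c + fps_X\<close> is \<open>z\<close>. Write
  \<open>z = j + (z - j)\<close>; the factor \<open>z - j\<close> lowers the order of the pole at
  \<open>j\<close> by one.\<close>

lemma residue_at_leibniz:
  assumes "finite A" "j \<in> A"
  shows "residue_at A ((fps_const c + fps_X) * H) (up j m) c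
       = j * residue_at A H (up j m) c + residue_at A H m c"
proof (cases "j = c")
  case True
  have "(fps_const c + fps_X) * H * cofactor A m c
      = fps_const c * (H * cofactor A m c) + fps_X * H * cofactor A m c"
    by (simp add: algebra_simps)
  with True show ?thesis
    by (simp only: residue_at_up_same fps_add_nth fps_mult_left_const_nth)
      (simp add: residue_at_def)
next
  case False
  let ?G = "fps_X * H * cofactor A m c"
  have "fps_const c + fps_X = fps_const j + (fps_X + fps_const (c - j))" by (simp add: fps_eq_iff)
  then have "fps_X * ((fps_const c + fps_X) * H) * cofactor A m c * inv_lin c j
      = fps_const j * (?G * inv_lin c j) + ?G * ((fps_X + fps_const (c - j)) * inv_lin c j)"
    by (simp only:) (simp only: algebra_simps)
  also have "\<dots> = fps_const j * (?G * inv_lin c j) + ?G"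
    using False by (simp add: inv_lin_cancel)
  finally have E: "fps_X * ((fps_const c + fps_X) * H) * cofactor A m c * inv_lin c j =
    fps_const j * (?G * inv_lin c j) + ?G" .
  show ?thesis
    unfolding residue_at_up[OF assms False] E fps_add_nth fps_mult_left_const_nth
    by (simp add: residue_at_def)
qed

section \<open>Differential equation and independence of the residues\<close>

lemma fps_deriv_inv_lin:
  assumes "c \<noteq> l"
  shows "fps_deriv (inv_lin c l) = - (inv_lin c l ^ 2)"
  unfolding inv_lin_def using assms by (subst fps_inverse_deriv) simp_all

lemma fps_deriv_inv_lin_power:
  assumes "c \<noteq> l"
  shows "fps_deriv (inv_lin c l ^ n) = - (of_nat n * inv_lin c l * inv_lin c l ^ n)"
  by (induction n) (simp_all add: fps_deriv_inv_lin[OF assms] power2_eq_square algebra_simps)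

lemma fps_deriv_cofactor:
  assumes "finite A"
  shows "fps_deriv (cofactor A m c) = - ((\<Sum>l\<in>A - {c}. of_nat (m l) * inv_lin c l) * cofactor A m c)"
proof -
  have "fps_deriv (\<Prod>l\<in>B. inv_lin c l ^ m l)
      = - ((\<Sum>l\<in>B. of_nat (m l) * inv_lin c l) * (\<Prod>l\<in>B. inv_lin c l ^ m l))"
    if "finite B" "c \<notin> B" for B
    using that
  proof (induction B rule: finite_induct)
    case (insert x F)
    then have "c \<noteq> x" "c \<notin> F" by auto
    with insert show ?case by (simp add: fps_deriv_inv_lin_power algebra_simps)
  qed simp
  from this[of "A - {c}"] show ?thesis unfolding cofactor_def using assms by simp
qed

text \<open>The total residue of the derivative of
  \<open>(1 + z s) powr (\<kappa> + 1) / (\<Prod>l\<in>A. (z - l) ^ m l)\<close> vanishes; this is the same statement at a single pole.\<close>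

lemma residue_at_ode:
  fixes \<kappa> s :: real
  assumes A: "finite A" "c \<in> A"
    and H: "(fps_const (1 + c * s) + fps_const s * fps_X) * fps_deriv H = fps_const (\<kappa> * s) * H"
  shows "(\<kappa> + 1 - real (\<Sum>l\<in>A. m l)) * s * residue_at A H m c
       = (\<Sum>l\<in>A. real (m l) * (1 + l * s) * residue_at A H (up l m) c)"
proof (cases "m c")
  case 0
  have "real (m l) * (1 + l * s) * residue_at A H (up l m) c = 0" for l
    using 0 by (cases "l = c") auto
  then have "(\<Sum>l\<in>A. real (m l) * (1 + l * s) * residue_at A H (up l m) c) = 0"
    by (intro sum.neutral) blast
  then show ?thesis using 0 by simp
next
  case (Suc n)
  let ?W = "cofactor A m c" and ?g = "fps_const (1 + c * s) + fps_const s * fps_X"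
  let ?G = "H * ?W"
  let ?B = "A - {c}"
  \<comment> \<open>That is, \<open>(1 + z s) / (z - l) = (1 + l s) / (z - l) + s\<close>.\<close>
  have lin: "?g * inv_lin c l = fps_const (1 + l * s) * inv_lin c l + fps_const s" if "l \<in> ?B" for l
  proof -
    have "?g = fps_const (1 + l * s) + fps_const s * (fps_X + fps_const (c - l))"
      by (simp add: fps_eq_iff algebra_simps fps_X_def)
    then have "?g * inv_lin c l = fps_const (1 + l * s) * inv_lin c l
        + fps_const s * ((fps_X + fps_const (c - l)) * inv_lin c l)"
      by (simp only:) (simp only: algebra_simps)
    then show ?thesis using that by (simp add: inv_lin_cancel)
  qed
  \<comment> \<open>The coefficient of index \<open>m c - 1\<close> of this derivative is computed
    twice: by the product rule here, and from the coefficients of \<open>?G\<close> below.\<close>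
  have "fps_deriv (?g * ?G) = fps_const s * ?G + (?g * fps_deriv H) * ?W + ?g * (H * fps_deriv ?W)"
    by (simp add: algebra_simps)
  also have "?g * (H * fps_deriv ?W) = - (\<Sum>l\<in>?B. of_nat (m l) * (?g * inv_lin c l) * ?G)"
    unfolding fps_deriv_cofactor[OF A(1)]
    by (simp add: sum_distrib_left sum_distrib_right mult_ac)
  also have "(\<Sum>l\<in>?B. of_nat (m l) * (?g * inv_lin c l) * ?G)
      = (\<Sum>l\<in>?B. fps_const (real (m l) * (1 + l * s)) * (?G * inv_lin c l) + fps_const (real (m l) * s) * ?G)"
    by (intro sum.cong refl, simp only: lin)
      (simp add: algebra_simps flip: fps_const_mult fps_of_nat fps_const_add)
  finally have "fps_deriv (?g * ?G) = fps_const s * ?G + fps_const (\<kappa> * s) * ?G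
      - (\<Sum>l\<in>?B. fps_const (real (m l) * (1 + l * s)) * (?G * inv_lin c l) + fps_const (real (m l) * s) * ?G)"
    unfolding H by (simp add: mult.assoc)
  then have "fps_nth (fps_deriv (?g * ?G)) n = s * fps_nth ?G n + \<kappa> * s * fps_nth ?G n
      - (\<Sum>l\<in>?B. real (m l) * (1 + l * s) * fps_nth (?G * inv_lin c l) n + real (m l) * s * fps_nth ?G n)"
    by (simp only: fps_add_nth fps_sub_nth fps_sum_nth fps_mult_left_const_nth)
  moreover have "fps_nth (fps_deriv (?g * ?G)) n
      = real (m c) * ((1 + c * s) * fps_nth ?G (Suc n) + s * fps_nth ?G n)"
  proof -
    have "?g * ?G = fps_const (1 + c * s) * ?G + fps_const s * (fps_X * ?G)"
      by (simp only: algebra_simps)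
    then have "fps_nth (?g * ?G) (Suc n) = (1 + c * s) * fps_nth ?G (Suc n) + s * fps_nth ?G n"
      by (simp only: fps_add_nth fps_mult_left_const_nth) simp
    moreover have "fps_nth (fps_deriv (?g * ?G)) n = of_nat (n + 1) * fps_nth (?g * ?G) (n + 1)"
      by (rule fps_deriv_nth)
    ultimately show ?thesis using Suc by (simp only: Suc_eq_plus1)
  qed
  moreover have "residue_at A H m c = fps_nth ?G n" using Suc by (simp add: residue_at_def mult.assoc)
  moreover have "residue_at A H (up c m) c = fps_nth ?G (Suc n)"
    using residue_at_up_same[of A H m c] Suc by simp
  moreover have "residue_at A H (up l m) c = fps_nth (?G * inv_lin c l) n" if "l \<in> ?B" for l
    using that A Suc by (simp add: residue_at_up mult.assoc)
  moreover have "(\<Sum>l\<in>A. m l) = m c + (\<Sum>l\<in>?B. m l)" using A by (simp add: sum.remove)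
  ultimately show ?thesis
    using A by (simp add: sum.remove[of A c] sum.distrib algebra_simps flip: sum_distrib_left sum_distrib_right)
qed

lemma up_decrement: "0 < m j \<Longrightarrow> m = up j (m(j := m j - 1))"
  by (simp add: fun_eq_iff)

lemma sum_up:
  assumes "finite A" "i \<in> A"
  shows "(\<Sum>l\<in>A. up i m l) = Suc (\<Sum>l\<in>A. m l)"
proof -
  have "(\<Sum>l\<in>A - {i}. up i m l) = (\<Sum>l\<in>A - {i}. m l)" by (rule sum.cong) auto
  then show ?thesis using assms by (simp add: sum.remove[of A i])
qed

text \<open>Descent on \<open>m\<close> replaces the evaluation of the usual determinant of the Pade approximants.\<close>

lemma residue_at_independent:
  fixes \<kappa> s :: real
  assumes A: "finite A" and s: "s \<noteq> 0" and \<kappa>: "\<And>n::nat. \<kappa> + 1 \<noteq> real n"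
    and ode: "\<And>c. c \<in> A \<Longrightarrow>
      (fps_const (1 + c * s) + fps_const s * fps_X) * fps_deriv (H c) = fps_const (\<kappa> * s) * H c"
    and H0: "\<And>c. c \<in> A \<Longrightarrow> fps_nth (H c) 0 \<noteq> 0"
    and zero: "\<And>i. i \<in> A \<Longrightarrow> (\<Sum>c\<in>A. v c * residue_at A (H c) (up i m) c) = 0"
    and c: "c \<in> A"
  shows "v c = 0"
  using zero
proof (induction "\<Sum>l\<in>A. m l" arbitrary: m)
  case 0
  then have m: "m l = 0" if "l \<in> A" for l using that A by simp
  have "residue_at A (H l) (up c m) l = (if l = c then fps_nth (H c) 0 else 0)" if "l \<in> A" for l
    using that m by (auto intro!: residue_at_single split: if_splits)
  then have "(\<Sum>l\<in>A. v l * residue_at A (H l) (up c m) l)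
      = (\<Sum>l\<in>A. if l = c then v c * fps_nth (H c) 0 else 0)"
    by (intro sum.cong) (simp_all del: fun_upd_apply)
  also have "\<dots> = v c * fps_nth (H c) 0" using A c by simp
  finally have "(\<Sum>l\<in>A. v l * residue_at A (H l) (up c m) l) = v c * fps_nth (H c) 0" .
  with 0(2)[OF c] have "v c * fps_nth (H c) 0 = 0" by (simp only:)
  with H0[OF c] show ?case by simp
next
  case (Suc n)
  let ?L = "\<lambda>m. \<Sum>c\<in>A. v c * residue_at A (H c) m c"
  obtain j where j: "j \<in> A" "0 < m j" using Suc(2) by (metis sum.neutral gr0I nat.distinct(1))
  define m' where "m' = m(j := m j - 1)"
  have m: "m = up j m'" unfolding m'_def by (rule up_decrement[of m j]) (rule j)
  \<comment> \<open>The local equations have coefficients independent of the pole, so they combine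
    into one relation for \<open>?L\<close>. Vanishing at every \<open>up l m\<close> thus forces
    vanishing at \<open>m\<close>, because \<open>\<kappa> + 1\<close> is not a natural
    number.\<close>
  have "(\<kappa> + 1 - real (\<Sum>l\<in>A. m l)) * s * ?L m
      = (\<Sum>c\<in>A. v c * (\<Sum>l\<in>A. real (m l) * (1 + l * s) * residue_at A (H c) (up l m) c))"
    unfolding sum_distrib_left
    by (intro sum.cong refl) (simp add: residue_at_ode[OF A _ ode, symmetric] flip: sum_distrib_left)
  also have "\<dots> = (\<Sum>l\<in>A. real (m l) * (1 + l * s) * ?L (up l m))"
    unfolding sum_distrib_left by (subst sum.swap) (simp add: mult_ac)
  also have "\<dots> = 0" by (intro sum.neutral ballI) (simp add: Suc(3))
  finally have Lm: "?L m = 0" using s \<kappa>[of "\<Sum>l\<in>A. m l"] by simp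
  \<comment> \<open>The hypothesis descends to \<open>m'\<close>: by partial fractions
    \<open>?L (up i m') - ?L (up j m')\<close> is a multiple of \<open>?L (up i m)\<close>, and
    \<open>up j m'\<close> is \<open>m\<close>.\<close>
  have "?L (up i m') = 0" if "i \<in> A" for i
  proof (cases "i = j")
    case True
    then show ?thesis using Lm m by simp
  next
    case False
    have "?L (up i m') - ?L (up j m') = (i - j) * ?L (up i (up j m'))"
      unfolding sum_distrib_left sum_subtractf[symmetric] right_diff_distrib[symmetric]
      using residue_at_diff[OF A that j(1) False] by (intro sum.cong refl) (metis mult.left_commute)
    also have "\<dots> = 0" using Suc(3)[OF that] m by simp
    finally show ?thesis using Lm m by simp
  qed
  moreover have "n = (\<Sum>l\<in>A. m' l)" using Suc(2) sum_up[OF A j(1), of m'] m by simp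
  ultimately show ?case by (rule Suc(1)[rotated])
qed

section \<open>Size and denominators of residues\<close>

text \<open>Partial fractions lower the total multiplicity until \<open>c\<close> is no pole or the
  only one; in the latter case the residue is a Taylor coefficient. Size and denominators can grow
  only through the divisions by \<open>c - l\<close>.\<close>

lemma residue_at_induct:
  assumes A: "finite A" "c \<in> A"
    and zero: "\<And>m. m c = 0 \<Longrightarrow> P m 0"
    and single: "\<And>m n. m c = Suc n \<Longrightarrow> (\<forall>l\<in>A - {c}. m l = 0) \<Longrightarrow> P m (fps_nth H n)"
    and step: "\<And>m l. l \<in> A - {c} \<Longrightarrow> P (up l m) (residue_at A H (up l m) c) \<Longrightarrow>
      P (up c m) (residue_at A H (up c m) c) \<Longrightarrow>
      P (up c (up l m)) ((residue_at A H (up c m) c - residue_at A H (up l m) c) / (c - l))"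
  shows "P m (residue_at A H m c)"
proof (induction "\<Sum>l\<in>A. m l" arbitrary: m rule: less_induct)
  case less
  consider "m c = 0" | n where "m c = Suc n" "\<forall>l\<in>A - {c}. m l = 0" | l where "l \<in> A - {c}" "0 < m l" "0 < m c"
    by (metis gr0I not0_implies_Suc)
  then show ?case
  proof cases
    case 1
    then show ?thesis by (simp add: zero)
  next
    case 2
    then show ?thesis using single[OF 2] residue_at_single[OF 2(2,1)] by simp
  next
    case (3 l)
    define m' where "m' = m(l := m l - 1, c := m c - 1)"
    have m: "m = up c (up l m')" using 3 by (auto simp: m'_def fun_eq_iff)
    have "P (up l m') (residue_at A H (up l m') c)" "P (up c m') (residue_at A H (up c m') c)"
      by (rule less; use 3 A in \<open>simp add: m sum_up del: fun_upd_apply\<close>)+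
    note P = step[OF 3(1) this]
    have "residue_at A H m c = (residue_at A H (up c m') c - residue_at A H (up l m') c) / (c - l)"
      unfolding m using residue_at_diff[of A c l H m' c] 3 A
      by (simp add: eq_divide_eq mult.commute del: fun_upd_apply)
    with P show ?thesis unfolding m by simp
  qed
qed

text \<open>A partial fraction step divides a difference of two residues by a number of absolute
  value at least 1, so it at most doubles the bound.\<close>

lemma abs_residue_at_le:
  assumes A: "finite A" "c \<in> A" and sep: "\<And>l. l \<in> A - {c} \<Longrightarrow> 1 \<le> \<bar>c - l\<bar>"
    and "\<And>h. h < m c \<Longrightarrow> \<bar>fps_nth H h\<bar> \<le> B" "0 \<le> B"
  shows "\<bar>residue_at A H m c\<bar> \<le> 2 ^ (\<Sum>l\<in>A. m l) * B"
proof -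
  have "(\<forall>h<m c. \<bar>fps_nth H h\<bar> \<le> B) \<longrightarrow> \<bar>residue_at A H m c\<bar> \<le> 2 ^ (\<Sum>l\<in>A. m l) * B"
  proof (rule residue_at_induct[OF A, where P = "\<lambda>m r. (\<forall>h<m c. \<bar>fps_nth H h\<bar> \<le> B) \<longrightarrow> \<bar>r\<bar> \<le> 2 ^ (\<Sum>l\<in>A. m l) * B"])
    fix m :: "real \<Rightarrow> nat" and n
    assume "m c = Suc n"
    moreover have "1 * B \<le> 2 ^ (\<Sum>l\<in>A. m l) * B" using assms by (intro mult_right_mono) auto
    ultimately show "(\<forall>h<m c. \<bar>fps_nth H h\<bar> \<le> B) \<longrightarrow> \<bar>fps_nth H n\<bar> \<le> 2 ^ (\<Sum>l\<in>A. m l) * B"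
      by (metis lessI mult_1 order_trans)
  next
    fix m l
    let ?u = "residue_at A H (up c m) c" and ?v = "residue_at A H (up l m) c"
    assume l: "l \<in> A - {c}"
      and v: "(\<forall>h<up l m c. \<bar>fps_nth H h\<bar> \<le> B) \<longrightarrow> \<bar>?v\<bar> \<le> 2 ^ (\<Sum>l'\<in>A. up l m l') * B"
      and u: "(\<forall>h<up c m c. \<bar>fps_nth H h\<bar> \<le> B) \<longrightarrow> \<bar>?u\<bar> \<le> 2 ^ (\<Sum>l\<in>A. up c m l) * B"
    show "(\<forall>h<up c (up l m) c. \<bar>fps_nth H h\<bar> \<le> B) \<longrightarrow> \<bar>(?u - ?v) / (c - l)\<bar> \<le> 2 ^ (\<Sum>l'\<in>A. up c (up l m) l') * B"
    proof
      assume h: "\<forall>h<up c (up l m) c. \<bar>fps_nth H h\<bar> \<le> B"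
      have "\<bar>?u\<bar> \<le> 2 ^ Suc (\<Sum>l\<in>A. m l) * B" "\<bar>?v\<bar> \<le> 2 ^ Suc (\<Sum>l\<in>A. m l) * B"
        using u v h l A by (simp_all add: sum_up del: power_Suc fun_upd_apply) (use l in auto)
      then have "\<bar>?u - ?v\<bar> \<le> 2 ^ Suc (Suc (\<Sum>l\<in>A. m l)) * B" by simp
      moreover have "\<bar>(?u - ?v) / (c - l)\<bar> \<le> \<bar>?u - ?v\<bar>"
        using divide_left_mono[OF sep[OF l], of "\<bar>?u - ?v\<bar>"] sep[OF l] by simp
      ultimately show "\<bar>(?u - ?v) / (c - l)\<bar> \<le> 2 ^ (\<Sum>l'\<in>A. up c (up l m) l') * B"
        using l A by (simp add: sum_up del: power_Suc fun_upd_apply)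
    qed
  qed (use assms in auto)
  then show ?thesis using assms by blast
qed

text \<open>\<open>K\<close> clears the Taylor coefficients, and one factor 2 for each partial
  fraction step clears the division by \<open>c - l\<close>.\<close>

lemma residue_at_integral:
  assumes A: "finite A" "c \<in> A" and sep: "\<And>l. l \<in> A - {c} \<Longrightarrow> 2 / (c - l) \<in> \<int>"
    and "\<And>h. h < m c \<Longrightarrow> K * fps_nth H h \<in> \<int>"
  shows "2 ^ (\<Sum>l\<in>A. m l) * K * residue_at A H m c \<in> \<int>"
proof -
  have "(\<forall>h<m c. K * fps_nth H h \<in> \<int>) \<longrightarrow> 2 ^ (\<Sum>l\<in>A. m l) * K * residue_at A H m c \<in> \<int>"
  proof (rule residue_at_induct[OF A, where P = "\<lambda>m r. (\<forall>h<m c. K * fps_nth H h \<in> \<int>) \<longrightarrow> 2 ^ (\<Sum>l\<in>A. m l) * K * r \<in> \<int>"])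
    fix m :: "real \<Rightarrow> nat" and n
    assume "m c = Suc n"
    then show "(\<forall>h<m c. K * fps_nth H h \<in> \<int>) \<longrightarrow> 2 ^ (\<Sum>l\<in>A. m l) * K * fps_nth H n \<in> \<int>"
      by (metis lessI mult.assoc Ints_mult Ints_power Ints_numeral)
  next
    fix m l
    let ?u = "residue_at A H (up c m) c" and ?v = "residue_at A H (up l m) c"
    assume l: "l \<in> A - {c}"
      and v: "(\<forall>h<up l m c. K * fps_nth H h \<in> \<int>) \<longrightarrow> 2 ^ (\<Sum>l'\<in>A. up l m l') * K * ?v \<in> \<int>"
      and u: "(\<forall>h<up c m c. K * fps_nth H h \<in> \<int>) \<longrightarrow> 2 ^ (\<Sum>l\<in>A. up c m l) * K * ?u \<in> \<int>"
    show "(\<forall>h<up c (up l m) c. K * fps_nth H h \<in> \<int>) \<longrightarrow> 2 ^ (\<Sum>l'\<in>A. up c (up l m) l') * K * ((?u - ?v) / (c - l)) \<in> \<int>"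
    proof
      assume h: "\<forall>h<up c (up l m) c. K * fps_nth H h \<in> \<int>"
      let ?M = "Suc (\<Sum>l\<in>A. m l)"
      have "2 ^ ?M * K * ?u \<in> \<int>" "2 ^ ?M * K * ?v \<in> \<int>"
        using u v h l A by (simp_all add: sum_up del: power_Suc fun_upd_apply) (use l in auto)
      then have "2 / (c - l) * (2 ^ ?M * K * ?u - 2 ^ ?M * K * ?v) \<in> \<int>"
        by (intro Ints_mult[OF sep[OF l]] Ints_diff)
      also have "2 / (c - l) * (2 ^ ?M * K * ?u - 2 ^ ?M * K * ?v) = 2 ^ Suc ?M * K * ((?u - ?v) / (c - l))"
        by (simp add: algebra_simps diff_divide_distrib)
      finally show "2 ^ (\<Sum>l'\<in>A. up c (up l m) l') * K * ((?u - ?v) / (c - l)) \<in> \<int>"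
        using l A by (simp add: sum_up del: power_Suc fun_upd_apply)
    qed
  qed auto
  then show ?thesis using assms by blast
qed

section \<open>Summation of series and divided differences of monomials\<close>

text \<open>A residue is a fixed finite linear combination of Taylor coefficients, so
  coefficientwise convergence passes to it.\<close>

lemma residue_at_sums:
  assumes "\<And>h. (\<lambda>n. u n * fps_nth (F n) h) sums (\<theta> * fps_nth H h)"
  shows "(\<lambda>n. u n * residue_at A (F n) m c) sums (\<theta> * residue_at A H m c)"
proof -
  let ?W = "fps_X * cofactor A m c"
  have e: "residue_at A G m c = (\<Sum>h=0..m c. fps_nth G h * fps_nth ?W (m c - h))" for G
    unfolding residue_at_def by (subst fps_mult_nth[symmetric]) (simp add: mult_ac)
  have "(\<lambda>n. \<Sum>h=0..m c. (u n * fps_nth (F n) h) * fps_nth ?W (m c - h))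
      sums (\<Sum>h=0..m c. (\<theta> * fps_nth H h) * fps_nth ?W (m c - h))"
    by (intro sums_sum sums_mult2 assms)
  then show ?thesis unfolding e by (simp add: sum_distrib_left mult.assoc)
qed

text \<open>The divided difference of \<open>z ^ n\<close> at the nodes \<open>A\<close> with multiplicities \<open>m\<close>.\<close>

definition monomial_dd :: "real set \<Rightarrow> nat \<Rightarrow> (real \<Rightarrow> nat) \<Rightarrow> real" where
  "monomial_dd A n m = (\<Sum>c\<in>A. residue_at A ((fps_const c + fps_X) ^ n) m c)"

text \<open>The residues of a rational function that decays like \<open>1 / z\<^sup>2\<close> or
  faster add up to 0. With two distinct poles, partial fractions reduce the claim to fewer poles; a
  single pole is immediate.\<close>

lemma monomial_dd_zero:
  assumes A: "finite A"
  shows "monomial_dd A 0 m = (if (\<Sum>l\<in>A. m l) = 1 then 1 else 0)"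
proof (induction "\<Sum>l\<in>A. m l" arbitrary: m rule: less_induct)
  case less
  consider "\<forall>l\<in>A. m l = 0" | i where "i \<in> A" "0 < m i" "\<forall>l\<in>A - {i}. m l = 0"
    | i j where "i \<in> A" "j \<in> A" "i \<noteq> j" "0 < m i" "0 < m j"
    by blast
  then show ?case
  proof cases
    case 1
    then show ?thesis by (simp add: monomial_dd_def)
  next
    case (2 i)
    then obtain n where n: "m i = Suc n" by (metis not0_implies_Suc less_numeral_extra(3))
    have "residue_at A ((fps_const c + fps_X) ^ 0) m c = (if c = i then (if n = 0 then 1 else 0) else 0)"
      if "c \<in> A" for c
      using that 2 residue_at_single[OF 2(3) n, of 1] by auto
    then have "monomial_dd A 0 m = (if n = 0 then 1 else 0)"
      unfolding monomial_dd_def using A 2(1) by simp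
    moreover have "(\<Sum>l\<in>A. m l) = Suc n" using 2 n A by (simp add: sum.remove[of A i])
    ultimately show ?thesis by simp
  next
    case (3 i j)
    define m' where "m' = m(j := m j - 1, i := m i - 1)"
    have m: "m = up i (up j m')" using 3 by (auto simp: m'_def fun_eq_iff)
    have s: "(\<Sum>l\<in>A. m l) = Suc (Suc (\<Sum>l\<in>A. m' l))" "(\<Sum>l\<in>A. up i m' l) = Suc (\<Sum>l\<in>A. m' l)"
      "(\<Sum>l\<in>A. up j m' l) = Suc (\<Sum>l\<in>A. m' l)"
      unfolding m using 3 A by (simp_all add: sum_up del: fun_upd_apply)
    have "(i - j) * monomial_dd A 0 m = monomial_dd A 0 (up i m') - monomial_dd A 0 (up j m')"
      unfolding monomial_dd_def m sum_distrib_left sum_subtractf[symmetric]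
      by (intro sum.cong refl residue_at_diff A 3)
    also have "\<dots> = 0" using s less[of "up i m'"] less[of "up j m'"] by (simp del: fun_upd_apply)
    finally show ?thesis using 3 s by simp
  qed
qed

lemma monomial_dd_Suc:
  assumes A: "finite A" "j \<in> A"
  shows "monomial_dd A (Suc n) (up j m) = j * monomial_dd A n (up j m) + monomial_dd A n m"
  unfolding monomial_dd_def sum_distrib_left sum.distrib[symmetric] power_Suc
  by (intro sum.cong refl residue_at_leibniz A)

text \<open>Both parts follow from the recursion \<open>monomial_dd_Suc\<close>. The vanishing for
  more than \<open>n + 1\<close> nodes gives the order of contact of the Pade approximants.\<close>

lemma monomial_dd_bounds:
  assumes A: "finite A" "\<And>j. j \<in> A \<Longrightarrow> \<bar>j\<bar> \<le> 1"
  shows "\<bar>monomial_dd A n m\<bar> \<le> 2 ^ n \<and> (Suc n < (\<Sum>l\<in>A. m l) \<longrightarrow> monomial_dd A n m = 0)"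
proof (induction n arbitrary: m)
  case 0
  then show ?case by (simp add: monomial_dd_zero A)
next
  case (Suc n)
  show ?case
  proof (cases "\<forall>l\<in>A. m l = 0")
    case True
    then show ?thesis by (simp add: monomial_dd_def)
  next
    case False
    then obtain j where j: "j \<in> A" "0 < m j" by blast
    define m' where "m' = m(j := m j - 1)"
    have m: "m = up j m'" unfolding m'_def by (rule up_decrement[of m j]) (rule j)
    have e: "monomial_dd A (Suc n) m = j * monomial_dd A n m + monomial_dd A n m'"
      unfolding m by (rule monomial_dd_Suc[OF A(1) j(1)])
    have "\<bar>j * monomial_dd A n m\<bar> \<le> 1 * 2 ^ n"
      unfolding abs_mult using A(2)[OF j(1)] Suc by (intro mult_mono) auto
    then have "\<bar>monomial_dd A (Suc n) m\<bar> \<le> 2 ^ Suc n" unfolding e using Suc[of m'] abs_triangle_ineq[of "j * monomial_dd A n m" "monomial_dd A n m'"] by simp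
    moreover have "monomial_dd A (Suc n) m = 0" if "Suc (Suc n) < (\<Sum>l\<in>A. m l)"
    proof -
      have "(\<Sum>l\<in>A. m l) = Suc (\<Sum>l\<in>A. m' l)" unfolding m by (rule sum_up[OF A(1) j(1)])
      then show ?thesis unfolding e using Suc[of m] Suc[of m'] that by simp
    qed
    ultimately show ?thesis by blast
  qed
qed

section \<open>Simultaneous Pade approximation of square roots\<close>

abbreviation half_odd :: "nat \<Rightarrow> real" where
  "half_odd k \<equiv> real k + 1 / 2"

text \<open>
  The Taylor series at \<open>z = c\<close> of \<open>(1 + z s) powr (k + 1 / 2) / sqrt (1 + c s)\<close>: the irrational factor
  is split off so that the residues become rational.
\<close>

definition root_taylor :: "nat \<Rightarrow> real \<Rightarrow> real \<Rightarrow> real fps" where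
  "root_taylor k s c = Abs_fps (\<lambda>h. (half_odd k gchoose h) * s ^ h * ((1 + c * s) ^ k / (1 + c * s) ^ h))"

lemma root_taylor_ode:
  assumes "1 + c * s \<noteq> 0"
  shows "(fps_const (1 + c * s) + fps_const s * fps_X) * fps_deriv (root_taylor k s c)
       = fps_const (half_odd k * s) * root_taylor k s c"
proof (rule fps_ext)
  fix h
  let ?g = "1 + c * s" and ?b = "\<lambda>h. half_odd k gchoose h"
  have "fps_nth ((fps_const ?g + fps_const s * fps_X) * fps_deriv (root_taylor k s c)) h
      = ?g * (real (Suc h) * fps_nth (root_taylor k s c) (Suc h)) + s * (real h * fps_nth (root_taylor k s c) h)"
    unfolding distrib_right mult.assoc fps_add_nth fps_mult_left_const_nth by (cases h) simp_all
  also have "\<dots> = (real (Suc h) * ?b (Suc h) + real h * ?b h) * (s ^ Suc h * (?g ^ k / ?g ^ h))"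
  proof -
    have "g * (real (Suc h) * (B' * s ^ Suc h * (G / g ^ Suc h))) + s * (real h * (B * s ^ h * (G / g ^ h)))
        = (real (Suc h) * B' + real h * B) * (s ^ Suc h * (G / g ^ h))" if "g \<noteq> 0" for g B B' G :: real
      using that by (simp add: field_simps)
    from this[OF assms] show ?thesis unfolding root_taylor_def fps_nth_Abs_fps .
  qed
  also have "real (Suc h) * ?b (Suc h) + real h * ?b h = half_odd k * ?b h"
    using gbinomial_mult_1[of "half_odd k" h] by simp
  finally show "fps_nth ((fps_const ?g + fps_const s * fps_X) * fps_deriv (root_taylor k s c)) h
      = fps_nth (fps_const (half_odd k * s) * root_taylor k s c) h"
    by (simp only: fps_mult_left_const_nth) (simp add: root_taylor_def)
qed

section \<open>Binomial coefficients of half-odd order\<close>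

text \<open>At \<open>- 1 / 2\<close> all coefficients have absolute value at most 1. Pascal's rule
  doubles the bound with each unit step, and \<open>half_odd k\<close> is \<open>k + 1\<close> steps
  away.\<close>

lemma abs_gbinomial_half_odd: "\<bar>half_odd k gchoose h\<bar> \<le> 2 ^ (k + 1)"
proof -
  have base: "\<bar>(- 1 / 2 :: real) gchoose h\<bar> \<le> 1" for h
  proof (induction h)
    case (Suc h)
    have "(- 1 / 2 :: real) gchoose Suc h = (- 1 / 2 gchoose h) * ((- 1 / 2 - real h) / real (Suc h))"
      using gbinomial_mult_1[of "- 1 / 2 :: real" h] by (simp add: field_simps)
    moreover have "\<bar>(- 1 / 2 - real h) / real (Suc h)\<bar> \<le> 1" by (simp add: abs_if field_simps)
    ultimately show ?case
      using mult_mono[OF Suc, of "\<bar>(- 1 / 2 - real h) / real (Suc h)\<bar>" 1] by (simp only: abs_mult) simp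
  qed simp
  have step: "\<bar>(a + 1) gchoose h\<bar> \<le> 2 * B" if "\<And>h. \<bar>a gchoose h\<bar> \<le> B" for a B :: real and h
  proof (cases h)
    case 0
    then show ?thesis using that[of 0] by simp
  next
    case (Suc n)
    then show ?thesis using gbinomial_Suc_Suc[of a n] that[of n] that[of "Suc n"] unfolding Suc by linarith
  qed
  show ?thesis
  proof (induction k arbitrary: h)
    case 0
    show ?case using step[OF base, of h] by simp
  next
    case (Suc k)
    show ?case using step[OF Suc, of h] by (simp add: add_ac)
  qed
qed

text \<open>At \<open>- 1 / 2\<close> the scaled coefficients are central binomial coefficients up
  to sign, and Pascal's rule preserves integrality.\<close>

lemma gbinomial_half_odd_integral: "4 ^ h * (half_odd k gchoose h) \<in> \<int>"
proof -
  have "4 ^ h * ((- 1 / 2 :: real) gchoose h) = (- 1) ^ h * real ((2 * h) choose h)" for h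
  proof (induction h)
    case (Suc h)
    \<comment> \<open>The extra factor \<open>Suc h\<close> makes the absorption identities
      applicable; it is cancelled at once.\<close>
    have "(Suc h * ((2 * Suc h) choose Suc h)) * Suc h = (2 * (2 * h + 1) * ((2 * h) choose h)) * Suc h"
      using Suc_times_binomial_eq[of "2 * h + 1" h] binomial_absorb_comp[of "2 * h + 1" h]
      by (simp add: algebra_simps)
    then have "Suc h * ((2 * Suc h) choose Suc h) = 2 * (2 * h + 1) * ((2 * h) choose h)"
      by (metis mult_cancel2 nat.distinct(1))
    then have "real (Suc h * ((2 * Suc h) choose Suc h)) = real (2 * (2 * h + 1) * ((2 * h) choose h))"
      by (simp only:)
    then have c: "real (Suc h) * real ((2 * Suc h) choose Suc h) = 2 * (2 * real h + 1) * real ((2 * h) choose h)"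
      unfolding of_nat_mult of_nat_add by simp
    have "4 ^ Suc h * ((- 1 / 2 :: real) gchoose Suc h) * real (Suc h)
        = 4 * (4 ^ h * (- 1 / 2 gchoose h)) * (- 1 / 2 - real h)"
      using gbinomial_mult_1[of "- 1 / 2 :: real" h] by (simp add: field_simps)
    also have "\<dots> = (- 1) ^ Suc h * (2 * (2 * real h + 1) * real ((2 * h) choose h))"
      unfolding Suc by (simp add: algebra_simps)
    also have "\<dots> = (- 1) ^ Suc h * real ((2 * Suc h) choose Suc h) * real (Suc h)"
      unfolding c[symmetric] by simp
    finally show ?case by (simp del: power_Suc)
  qed simp
  then have base: "4 ^ h * ((- 1 / 2 :: real) gchoose h) \<in> \<int>" for h by simp
  have step: "4 ^ h * ((a + 1) gchoose h) \<in> \<int>" if "\<And>h. 4 ^ h * (a gchoose h) \<in> \<int>" for a :: real and h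
  proof (cases h)
    case (Suc n)
    have "4 ^ Suc n * ((a + 1) gchoose Suc n) = 4 * (4 ^ n * (a gchoose n)) + 4 ^ Suc n * (a gchoose Suc n)"
      unfolding gbinomial_Suc_Suc by (simp add: algebra_simps)
    then show ?thesis using that[of n] that[of "Suc n"] Suc by (metis Ints_add Ints_mult Ints_numeral)
  qed simp
  show ?thesis
  proof (induction k arbitrary: h)
    case 0
    show ?case using step[OF base, of h] by simp
  next
    case (Suc k)
    show ?case using step[OF Suc, of h] by (simp add: add_ac)
  qed
qed

lemma fps_nth_linear_power:
  "fps_nth ((fps_const c + fps_X) ^ n) h = (if h \<le> n then of_nat (n choose h) * c ^ (n - h) else 0)"
  for c :: real
proof (induction n arbitrary: h)
  case (Suc n)
  have "fps_nth ((fps_const c + fps_X) ^ Suc n) h = c * fps_nth ((fps_const c + fps_X) ^ n) h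
      + (if h = 0 then 0 else fps_nth ((fps_const c + fps_X) ^ n) (h - 1))"
    by (simp add: distrib_right)
  then show ?case unfolding Suc
    by (cases h) (auto simp: Suc_diff_le algebra_simps not_le le_Suc_eq Suc_diff_Suc simp flip: power_Suc)
qed auto

text \<open>The binomial series in \<open>z s\<close> about the origin is expanded again about
  \<open>c\<close>, by trinomial revision. The square root split off in \<open>root_taylor\<close>
  reappears as a factor.\<close>

lemma root_taylor_sums:
  assumes "\<bar>c * s\<bar> < 1"
  shows "(\<lambda>n. ((half_odd k gchoose n) * s ^ n) * fps_nth ((fps_const c + fps_X) ^ n) h)
    sums (sqrt (1 + c * s) * fps_nth (root_taylor k s c) h)"
proof -
  let ?f = "\<lambda>n. ((half_odd k gchoose n) * s ^ n) * fps_nth ((fps_const c + fps_X) ^ n) h"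
  let ?b = "(half_odd k gchoose h) * s ^ h"
  have pos: "0 < 1 + c * s" using assms by linarith
  have "(\<lambda>n. ?b * (((half_odd k - real h) gchoose n) * (c * s) ^ n))
      sums (?b * (1 + c * s) powr (half_odd k - real h))"
    by (intro sums_mult gen_binomial_real assms)
  also have "(1 + c * s) powr (half_odd k - real h) = sqrt (1 + c * s) * ((1 + c * s) ^ k / (1 + c * s) ^ h)"
    using pos by (simp add: powr_diff powr_add powr_realpow powr_half_sqrt)
  also have "(\<lambda>n. ?b * (((half_odd k - real h) gchoose n) * (c * s) ^ n)) = (\<lambda>n. ?f (n + h))"
  proof
    fix n
    have "(half_odd k gchoose (n + h)) * real ((n + h) choose h)
        = (half_odd k gchoose h) * ((half_odd k - real h) gchoose n)"
      using gbinomial_trinomial_revision[of h "n + h" "half_odd k"] by (simp add: binomial_gbinomial)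
    then show "?b * (((half_odd k - real h) gchoose n) * (c * s) ^ n) = ?f (n + h)"
      unfolding fps_nth_linear_power by (simp add: power_add power_mult_distrib mult_ac)
  qed
  finally have "(\<lambda>n. ?f (n + h)) sums (sqrt (1 + c * s) * fps_nth (root_taylor k s c) h)"
    by (simp add: root_taylor_def mult_ac)
  \<comment> \<open>For \<open>n < h\<close> the polynomial \<open>z ^ n\<close> has no term of
    degree \<open>h\<close> in \<open>z - c\<close>.\<close>
  moreover have "(\<Sum>n<h. ?f n) = 0" by (intro sum.neutral) (simp add: fps_nth_linear_power)
  ultimately show ?thesis by (subst (asm) sums_iff_shift) simp
qed

text \<open>The sum of residues equals a power series in \<open>s\<close> whose coefficients are
  binomial coefficients times \<open>monomial_dd A n m\<close>. The first \<open>K\<close> terms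
  vanish, and the rest is dominated by a geometric series because
  \<open>2 * s \<le> 1 / 2\<close>.\<close>

lemma pade_remainder_bound:
  assumes A: "finite A" "\<And>j. j \<in> A \<Longrightarrow> \<bar>j\<bar> \<le> 1" and s: "0 < s" "s \<le> 1 / 4"
    and M: "(\<Sum>l\<in>A. m l) = Suc K"
  shows "\<bar>\<Sum>c\<in>A. sqrt (1 + c * s) * residue_at A (root_taylor k s c) m c\<bar> \<le> 2 ^ (k + 2) * (2 * s) ^ K"
proof -
  let ?u = "\<lambda>n. (half_odd k gchoose n) * s ^ n" and ?R = "\<Sum>c\<in>A. sqrt (1 + c * s) * residue_at A (root_taylor k s c) m c"
  let ?f = "\<lambda>n. ?u n * monomial_dd A n m" and ?B = "2 ^ (k + 1) * (2 * s) ^ K"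
  have cs: "\<bar>c * s\<bar> < 1" if "c \<in> A" for c
    using mult_mono[OF A(2)[OF that], of s "1 / 4"] s A(2)[OF that] by (simp add: abs_mult) 
  have "?f sums ?R"
    unfolding monomial_dd_def sum_distrib_left
    by (intro sums_sum residue_at_sums root_taylor_sums cs)
  moreover have "(\<Sum>n<K. ?f n) = 0"
    using monomial_dd_bounds[OF A, where m = m] M by (intro sum.neutral) auto
  ultimately have f: "(\<lambda>n. ?f (n + K)) sums ?R" by (subst sums_iff_shift) simp
  have le: "\<bar>?f (n + K)\<bar> \<le> ?B * (1 / 2) ^ n" for n
  proof -
    have "\<bar>?f (n + K)\<bar> \<le> 2 ^ (k + 1) * s ^ (n + K) * 2 ^ (n + K)"
      unfolding abs_mult using monomial_dd_bounds[OF A, of "n + K" m] abs_gbinomial_half_odd[of k "n + K"] s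
      by (intro mult_mono) (auto simp: power_abs)
    also have "\<dots> = ?B * (2 * s) ^ n" by (simp add: power_add power_mult_distrib)
    also have "\<dots> \<le> ?B * (1 / 2) ^ n" using s by (intro mult_left_mono power_mono) auto
    finally show ?thesis .
  qed
  have g: "(\<lambda>n. ?B * (1 / 2) ^ n) sums (?B * (1 / (1 - 1 / 2)))"
    by (intro sums_mult geometric_sums) simp
  have "?R \<le> ?B * (1 / (1 - 1 / 2))" using le by (intro sums_le[OF _ f g]) (metis abs_le_D1)
  moreover have "- ?R \<le> ?B * (1 / (1 - 1 / 2))"
    using le by (intro sums_le[OF _ sums_minus[OF f] g]) (metis abs_le_D2)
  ultimately show ?thesis by simp
qed

section \<open>A bound for simultaneous rational approximation\<close>

text \<open>Apply the Pade forms to the integer vector \<open>(p1, q, p2)\<close>. Some form is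
  nonzero, so after clearing denominators it is at least 1 in absolute value. It is also at most
  \<open>q\<close> times the Pade remainder plus the approximation errors weighted by the
  residues.\<close>

lemma pade_inequality:
  fixes N q p1 p2 :: int and k :: nat and \<delta> :: real
  defines "\<delta> \<equiv> max \<bar>p1 - q * sqrt (1 - 4 / N)\<bar> \<bar>p2 - q * sqrt (1 + 4 / N)\<bar>"
  assumes N: "16 \<le> N" and q: "0 < q"
  shows "1 \<le> 8 * q * (8192 / N ^ 2) ^ k + 24 * (256 * N) ^ k * \<delta>"
proof -
  define A :: "real set" where "A = {- 1, 0, 1}"
  define s :: real where "s = 4 / N"
  define H where "H = root_taylor k s"
  define v :: "real \<Rightarrow> real" where "v c = (if c = - 1 then p1 else if c = 0 then q else p2)" for c
  define m :: "real \<Rightarrow> nat" where "m = (\<lambda>_. k)"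
  \<comment> \<open>A common denominator of the residues: \<open>2 ^ Suc (3 * k)\<close> for the
    partial fractions and \<open>N ^ k\<close> for the Taylor coefficients.\<close>
  define D :: real where "D = 2 ^ Suc (3 * k) * real_of_int N ^ k"
  have A: "finite A" "\<And>c. c \<in> A \<Longrightarrow> \<bar>c\<bar> \<le> 1" by (auto simp: A_def)
  have s: "0 < s" "s \<le> 1 / 4" using N by (auto simp: s_def field_simps)
  have cs: "0 < 1 + c * s" "1 + c * s \<le> 2" if "c \<in> A" for c using that s by (auto simp: A_def)
  have M: "(\<Sum>l\<in>A. up i m l) = Suc (3 * k)" if "i \<in> A" for i
    using sum_up[OF A(1) that, of m] by (simp add: m_def A_def)
  have mc: "up i m c \<le> k + 1" for i c by (simp add: m_def)
  have pw: "(1 + c * s) ^ k / (1 + c * s) ^ h = (1 + c * s) ^ (k - h)" if "c \<in> A" "h \<le> k" for c h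
    using cs[OF that(1)] that(2) by (simp add: power_diff)
  \<comment> \<open>Were all three forms zero, one for each raised node, independence would give
    \<open>v 0 = q = 0\<close>. It applies because \<open>k + 3 / 2\<close> is never a natural
    number.\<close>
  obtain i where i: "i \<in> A" and nz: "(\<Sum>c\<in>A. v c * residue_at A (H c) (up i m) c) \<noteq> 0"
  proof (rule ccontr)
    assume "\<not> thesis"
    then have z: "\<And>i. i \<in> A \<Longrightarrow> (\<Sum>c\<in>A. v c * residue_at A (H c) (up i m) c) = 0"
      using that by blast
    have "half_odd k + 1 \<noteq> real n" for n
    proof
      assume "half_odd k + 1 = real n"
      then have "real (2 * k + 3) = real (2 * n)" by simp
      then have "2 * k + 3 = 2 * n" by (simp only: of_nat_eq_iff)
      then show False by presburger
    qed
    moreover have "1 + c * s \<noteq> 0" if "c \<in> A" for c using cs[OF that] by simp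
    ultimately have "v 0 = 0"
      using s
      by (intro residue_at_independent[OF A(1) _ _ _ _ z, where \<kappa> = "half_odd k" and s = s])
        (auto simp: H_def root_taylor_ode root_taylor_def[THEN arg_cong[where f = "\<lambda>f. fps_nth f 0"]], simp add: A_def)
    then show False using q by (simp add: v_def)
  qed
  let ?r = "\<lambda>c. residue_at A (H c) (up i m) c"
  let ?L = "\<Sum>c\<in>A. v c * ?r c"
  have int: "D * ?r c \<in> \<int>" if c: "c \<in> A" for c
  proof -
    have "2 ^ (\<Sum>l\<in>A. up i m l) * real_of_int N ^ k * ?r c \<in> \<int>"
    proof (rule residue_at_integral[OF A(1) c])
      show "2 / (c - l) \<in> \<int>" if "l \<in> A - {c}" for l using that c by (auto simp: A_def)
      fix h assume "h < up i m c"
      then have h: "h \<le> k" using mc[of i c] by linarith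
      have "real_of_int N ^ k * fps_nth (H c) h
          = real_of_int N ^ k * ((half_odd k gchoose h) * (4 ^ h / N ^ h) * ((N + 4 * c) ^ (k - h) / N ^ (k - h)))"
      proof -
        have "1 + c * s = (N + 4 * c) / N" using N by (simp add: s_def field_simps)
        then show ?thesis unfolding H_def root_taylor_def fps_nth_Abs_fps pw[OF c h]
          by (simp only: power_divide) (simp add: s_def power_divide)
      qed
      \<comment> \<open>The numerator of \<open>s = 4 / N\<close> supplies the \<open>4 ^ h\<close>
        that makes the binomial coefficient integral.\<close>
      also have "\<dots> = (4 ^ h * (half_odd k gchoose h)) * (N + 4 * c) ^ (k - h)"
      proof -
        have "real_of_int N ^ k = N ^ h * N ^ (k - h)" using h by (simp flip: power_add)
        then show ?thesis using N by simp
      qed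
      also have "\<dots> \<in> \<int>"
        by (intro Ints_mult gbinomial_half_odd_integral Ints_power Ints_add) (use c in \<open>auto simp: A_def\<close>)
      finally show "real_of_int N ^ k * fps_nth (H c) h \<in> \<int>" .
    qed
    then show ?thesis by (simp only: M[OF i] D_def)
  qed
  have v: "v c \<in> \<int>" for c by (simp add: v_def)
  have "D * ?L = (\<Sum>c\<in>A. v c * (D * ?r c))" by (simp add: sum_distrib_left mult_ac)
  also have "\<dots> \<in> \<int>" by (intro Ints_sum Ints_mult v int)
  finally have L_int: "D * ?L \<in> \<int>" .
  have D: "0 < D" using N by (simp add: D_def)
  have "1 \<le> \<bar>D * ?L\<bar>" using Ints_nonzero_abs_ge1[OF L_int] nz D by simp
  also have "\<dots> = D * \<bar>?L\<bar>" using D by (simp add: abs_mult)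
  finally have low: "1 \<le> D * \<bar>?L\<bar>" .
  have r: "\<bar>?r c\<bar> \<le> 2 ^ Suc (3 * k) * 2 ^ (2 * k + 1)" if c: "c \<in> A" for c
  proof -
    have "\<bar>?r c\<bar> \<le> 2 ^ (\<Sum>l\<in>A. up i m l) * 2 ^ (2 * k + 1)"
    proof (rule abs_residue_at_le[OF A(1) c])
      show "1 \<le> \<bar>c - l\<bar>" if "l \<in> A - {c}" for l using that c by (auto simp: A_def)
      fix h assume "h < up i m c"
      then have h: "h \<le> k" using mc[of i c] by linarith
      have "\<bar>fps_nth (H c) h\<bar> = \<bar>half_odd k gchoose h\<bar> * s ^ h * (1 + c * s) ^ (k - h)"
        unfolding H_def root_taylor_def fps_nth_Abs_fps pw[OF c h] using cs[OF c] s by (simp add: abs_mult)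
      also have "\<dots> \<le> 2 ^ (k + 1) * 1 ^ h * 2 ^ k"
      proof (intro mult_mono abs_gbinomial_half_odd power_mono)
        show "(1 + c * s) ^ (k - h) \<le> 2 ^ k"
          by (rule order_trans[OF power_mono power_increasing, of _ 2]) (use cs[OF c] in auto)
      qed (use s cs[OF c] in auto)
      also have "(2::real) ^ (k + 1) * 1 ^ h * 2 ^ k = 2 ^ (2 * k + 1)"
        by (simp add: power_mult flip: power_mult_distrib)
      finally show "\<bar>fps_nth (H c) h\<bar> \<le> 2 ^ (2 * k + 1)" .
    qed simp
    then show ?thesis by (simp only: M[OF i])
  qed
  have vd: "\<bar>v c - q * sqrt (1 + c * s)\<bar> \<le> \<delta>" if "c \<in> A" for c
    using that by (auto simp: A_def v_def s_def \<delta>_def)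
  have "?L = q * (\<Sum>c\<in>A. sqrt (1 + c * s) * ?r c) + (\<Sum>c\<in>A. (v c - q * sqrt (1 + c * s)) * ?r c)"
    unfolding sum_distrib_left sum.distrib[symmetric] by (intro sum.cong) (simp_all add: algebra_simps)
  then have "\<bar>?L\<bar> \<le> \<bar>q * (\<Sum>c\<in>A. sqrt (1 + c * s) * ?r c)\<bar> + \<bar>\<Sum>c\<in>A. (v c - q * sqrt (1 + c * s)) * ?r c\<bar>"
    by (simp only: abs_triangle_ineq)
  also have "\<bar>q * (\<Sum>c\<in>A. sqrt (1 + c * s) * ?r c)\<bar> \<le> q * (2 ^ (k + 2) * (2 * s) ^ (3 * k))"
    unfolding abs_mult H_def using q
    by (intro mult_mono pade_remainder_bound[OF A s M[OF i]]) auto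
  also have "\<bar>\<Sum>c\<in>A. (v c - q * sqrt (1 + c * s)) * ?r c\<bar>
      \<le> (\<Sum>c\<in>A. \<delta> * (2 ^ Suc (3 * k) * 2 ^ (2 * k + 1)))"
    by (rule order_trans[OF sum_abs sum_mono], unfold abs_mult, intro mult_mono vd r)
      (auto simp: \<delta>_def)
  finally have "D * \<bar>?L\<bar> \<le> D * (q * (2 ^ (k + 2) * (2 * s) ^ (3 * k))
      + (\<Sum>c\<in>A. \<delta> * (2 ^ Suc (3 * k) * 2 ^ (2 * k + 1))))"
    using D by simp
  also have "\<dots> = D * (q * (2 ^ (k + 2) * (2 * s) ^ (3 * k))) + 3 * D * \<delta> * (2 ^ Suc (3 * k) * 2 ^ (2 * k + 1))"
    by (simp add: A_def algebra_simps)
  \<comment> \<open>Here \<open>8192 = 8 * 2 * 8 ^ 3\<close>: from \<open>D\<close>, from the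
    binomial bound, and from \<open>(2 * s) ^ 3 = (8 / N) ^ 3\<close>.\<close>
  also have "D * (q * (2 ^ (k + 2) * (2 * s) ^ (3 * k))) = 8 * q * (8192 / N ^ 2) ^ k"
  proof -
    have "D * (q * (2 ^ (k + 2) * (2 * s) ^ (3 * k))) = 8 * q * ((2 ^ 3 * real_of_int N) ^ k * (2 * (2 * s) ^ 3) ^ k)"
    proof -
      have "(16::real) ^ k = 2 ^ k * 8 ^ k" by (simp flip: power_mult_distrib)
      then show ?thesis by (simp add: D_def power_add power_mult power_mult_distrib)
    qed
    also have "(2 ^ 3 * real_of_int N) ^ k * (2 * (2 * s) ^ 3) ^ k = (8192 / N ^ 2) ^ k"
      unfolding power_mult_distrib[symmetric] using N
      by (simp add: s_def power_divide eval_nat_numeral)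
    finally show ?thesis .
  qed
  also have "3 * D * \<delta> * (2 ^ Suc (3 * k) * 2 ^ (2 * k + 1)) = 24 * (256 * N) ^ k * \<delta>"
  proof -
    have "2 ^ (3 * k) * (2 ^ (3 * k) * 2 ^ (2 * k)) = (256::real) ^ k"
      by (simp add: power_mult flip: power_mult_distrib)
    then show ?thesis by (simp add: D_def power_add power_mult_distrib)
  qed
  finally show ?thesis using low by linarith
qed

text \<open>Take the least \<open>k\<close> that makes the first term of
  \<open>pade_inequality\<close> less than 1/2. Its minimality bounds \<open>N ^ (2 * k - 2)\<close>
  in terms of \<open>q\<close>, which makes the second term less than 1/2 too.\<close>

lemma no_simultaneous_approximation:
  fixes N q p1 p2 :: int
  assumes N: "8192 ^ 6 \<le> N" and q: "N ^ 8 \<le> q"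
    and p1: "\<bar>p1 - q * sqrt (1 - 4 / N)\<bar> \<le> 4 * N / q"
    and p2: "\<bar>p2 - q * sqrt (1 + 4 / N)\<bar> \<le> 4 * N / q"
  shows False
proof -
  define C :: real where "C = 8192"
  define n :: real where "n = N"
  define Q :: real where "Q = q"
  have C: "1 < C" "3072 < C" by (simp_all add: C_def)
  have n: "C ^ 6 \<le> n" unfolding n_def C_def using N of_int_le_iff[of "8192 ^ 6" N] by simp
  have nC: "C < n" using n power_strict_increasing[of 1 6 C] C by simp
  have n1: "1 < n" using nC C by simp
  have N1: "16 \<le> N" using N by simp
  have Qn: "n ^ 8 \<le> Q" unfolding n_def Q_def using q of_int_le_iff[of "N ^ 8" q] by simp
  have Q1: "1 < Q" using Qn one_less_power[OF n1, of 8] by linarith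
  have "n < n\<^sup>2" using n1 by (simp add: power2_eq_square)
  then have "1 < n\<^sup>2 / C" using nC C by (simp add: field_simps)
  then obtain k0 where "16 * Q < (n\<^sup>2 / C) ^ k0" using real_arch_pow by blast
  then have ex: "\<exists>k. 16 * Q * C ^ k < (n\<^sup>2) ^ k"
    using C by (auto simp: power_divide field_simps)
  define k where "k = (LEAST k. 16 * Q * C ^ k < (n\<^sup>2) ^ k)"
  have k: "16 * Q * C ^ k < (n\<^sup>2) ^ k" unfolding k_def by (rule LeastI_ex[OF ex])
  \<comment> \<open>This is where \<open>N ^ 8 \<le> q\<close> enters. With \<open>k = j + 5\<close>
    there are enough powers of \<open>n\<close> in \<open>key\<close> to absorb those of
    \<open>C\<close>.\<close>
  have "4 < k"
  proof (rule ccontr)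
    assume "\<not> 4 < k"
    then have "(n\<^sup>2) ^ k \<le> n ^ 8"
      unfolding power_mult[symmetric] using n1 by (intro power_increasing) auto
    also have "\<dots> \<le> Q * 1" using Qn by simp
    also have "\<dots> \<le> Q * C ^ k" using Q1 C by (intro mult_left_mono one_le_power) auto
    finally have "(n\<^sup>2) ^ k \<le> Q * C ^ k" .
    moreover have "0 < Q * C ^ k" using Q1 C by simp
    moreover have "16 * (Q * C ^ k) < (n\<^sup>2) ^ k" using k by (simp only: mult.assoc)
    ultimately show False by linarith
  qed
  define j where "j = k - 5"
  with \<open>4 < k\<close> have j: "k = j + 5" by simp
  have "\<not> 16 * Q * C ^ (j + 4) < (n\<^sup>2) ^ (j + 4)"
    by (rule not_less_Least) (simp add: j flip: k_def)
  then have lowQ: "n ^ (2 * j + 8) \<le> 16 * Q * C ^ (j + 4)" by (simp add: power_mult[symmetric] not_less)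
  \<comment> \<open>One \<open>C\<close> absorbs 3072, the product of the constants 192 and 16
    below; then \<open>2 * j + 10 \<le> 6 * (j + 2)\<close> and
    \<open>C ^ 6 \<le> n\<close>.\<close>
  have key: "3072 * C ^ (2 * j + 9) < n ^ (j + 2)"
  proof -
    have "3072 * C ^ (2 * j + 9) < C * C ^ (2 * j + 9)" using C by simp
    also have "\<dots> = C ^ (2 * j + 10)" by (simp add: add.commute flip: power_Suc)
    also have "\<dots> \<le> C ^ (6 * (j + 2))" using C by (intro power_increasing) auto
    also have "\<dots> = (C ^ 6) ^ (j + 2)" by (simp only: power_mult)
    also have "\<dots> \<le> n ^ (j + 2)" using n C by (intro power_mono) auto
    finally show ?thesis .
  qed
  have "(192 * n * (C * n) ^ k) * (16 * C ^ (j + 4)) = (3072 * C ^ (2 * j + 9)) * n ^ (j + 6)"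
    by (simp add: j power_mult_distrib power_add power_mult eval_nat_numeral mult_2 algebra_simps)
  also have "\<dots> < n ^ (j + 2) * n ^ (j + 6)" using key n1 by (intro mult_strict_right_mono) auto
  also have "\<dots> = n ^ (2 * j + 8)"
    by (rule trans[OF power_add[symmetric] arg_cong[where f = "\<lambda>e. n ^ e"]]) simp
  also have "\<dots> \<le> Q * (16 * C ^ (j + 4))" using lowQ by (simp add: mult_ac)
  finally have "(192 * n * (C * n) ^ k) * (16 * C ^ (j + 4)) < Q * (16 * C ^ (j + 4))" .
  then have small2: "192 * n * (C * n) ^ k < Q"
    by (rule mult_right_less_imp_less) (use C in simp)
  have "8 * Q * (C / n\<^sup>2) ^ k = (16 * Q * C ^ k) / (2 * (n\<^sup>2) ^ k)" by (simp add: power_divide)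
  also have "\<dots> < 1 / 2" using k n1 by (subst divide_less_eq) simp
  finally have small1: "8 * Q * (C / n\<^sup>2) ^ k < 1 / 2" .
  have "1 \<le> 8 * Q * (C / n\<^sup>2) ^ k + 24 * (256 * n) ^ k *
      max \<bar>p1 - q * sqrt (1 - 4 / N)\<bar> \<bar>p2 - q * sqrt (1 + 4 / N)\<bar>"
    using pade_inequality[OF N1, of q k p1 p2] Q1 by (simp add: Q_def n_def C_def)
  also have "\<dots> \<le> 8 * Q * (C / n\<^sup>2) ^ k + 24 * (C * n) ^ k * (4 * n / Q)"
    using p1 p2 n1 by (intro add_left_mono mult_mono power_mono mult_right_mono) (auto simp: n_def Q_def C_def)
  also have "24 * (C * n) ^ k * (4 * n / Q) < 1 / 2" using small2 Q1 by (simp add: field_simps)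
  finally show False using small1 by simp
qed

section \<open>Simultaneous Pell equations\<close>

text \<open>With \<open>X = sqrt (x\<^sup>2 + \<epsilon>)\<close> and
  \<open>B = sqrt (b\<^sup>2 + \<epsilon>)\<close>, the integer \<open>D * w * w0\<close> is
  \<open>X * B\<close>, while \<open>x * b * sqrt (1 + \<epsilon> / b\<^sup>2)\<close> is
  \<open>x * B\<close>. They are close since \<open>(X - x) * (X + x) = \<epsilon>\<close>. The
  denominator \<open>x * b\<close> serves both signs of \<open>\<epsilon>\<close>.\<close>

lemma pell_approximation:
  fixes b x w0 w D \<epsilon> :: int
  assumes b: "16 \<le> b" and x: "16 \<le> x" and w: "0 \<le> w0" "0 \<le> w"
    and e: "\<bar>\<epsilon>\<bar> = 4" "b\<^sup>2 + \<epsilon> = D * w0\<^sup>2" "x\<^sup>2 + \<epsilon> = D * w\<^sup>2"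
  shows "\<bar>(D * w * w0) - (x * b) * sqrt (1 + \<epsilon> / b\<^sup>2)\<bar> \<le> 4 * b\<^sup>2 / (x * b)"
proof -
  define B where "B = sqrt (b\<^sup>2 + \<epsilon>)"
  define X where "X = sqrt (x\<^sup>2 + \<epsilon>)"
  have sq: "256 \<le> b\<^sup>2" "256 \<le> x\<^sup>2" using power_mono[OF b, of 2] power_mono[OF x, of 2] by simp_all
  have pos: "0 < b\<^sup>2 + \<epsilon>" "0 < x\<^sup>2 + \<epsilon>" using sq e(1) by linarith+
  have B2: "B\<^sup>2 = b\<^sup>2 + \<epsilon>" and X2: "X\<^sup>2 = x\<^sup>2 + \<epsilon>"
    using pos by (simp_all add: B_def X_def flip: of_int_power of_int_add)
  have BX: "0 < B" "0 < X"
    using pos by (simp_all add: B_def X_def flip: of_int_power of_int_add)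
  have "0 < D * w0\<^sup>2" using pos e by simp
  then have "0 \<le> D" by (simp add: zero_less_mult_iff)
  then have nonneg: "0 \<le> real_of_int (D * w * w0)" using w by simp
  have "(real_of_int (D * w * w0))\<^sup>2 = (X * B)\<^sup>2"
  proof -
    have "(D * w * w0)\<^sup>2 = (x\<^sup>2 + \<epsilon>) * (b\<^sup>2 + \<epsilon>)"
      unfolding e by (simp add: power2_eq_square mult_ac)
    then have "real_of_int ((D * w * w0)\<^sup>2) = real_of_int ((x\<^sup>2 + \<epsilon>) * (b\<^sup>2 + \<epsilon>))" by (simp only:)
    then show ?thesis
      unfolding power_mult_distrib[of X] B2 X2 of_int_power of_int_mult[of "x\<^sup>2 + \<epsilon>"] .
  qed
  then have 1: "real_of_int (D * w * w0) = X * B"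
    by (rule power2_eq_imp_eq[OF _ nonneg]) (use BX in simp)
  have "sqrt (1 + \<epsilon> / b\<^sup>2) = B / b"
  proof -
    have "1 + \<epsilon> / b\<^sup>2 = (b\<^sup>2 + \<epsilon>) / (real_of_int b)\<^sup>2" using b by (simp add: add_divide_distrib)
    then show ?thesis using b by (simp add: B_def real_sqrt_divide)
  qed
  then have 2: "(x * b) * sqrt (1 + \<epsilon> / b\<^sup>2) = x * B" using b by simp
  have "(X - x) * (X + x) = \<epsilon>" using X2 by (simp add: power2_eq_square algebra_simps)
  then have "\<bar>X - x\<bar> * (X + x) = \<bar>real_of_int \<epsilon>\<bar>" using BX x by (simp add: abs_mult flip: \<open>(X - x) * (X + x) = \<epsilon>\<close>)
  then have 3: "\<bar>X - x\<bar> * (X + x) = 4" using e(1) by (metis of_int_abs of_int_numeral)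
  \<comment> \<open>The crude bounds \<open>B \<le> b + 1\<close> and \<open>x / 2 \<le> X\<close>
    give \<open>B * x \<le> b * (X + x)\<close>, so the error \<open>4 * B / (X + x)\<close> is at
    most \<open>4 * b / x\<close>.\<close>
  have "B\<^sup>2 \<le> (real_of_int b + 1)\<^sup>2" unfolding B2 using e(1) b by (simp add: power2_eq_square algebra_simps)
  then have Bb: "B \<le> b + 1" using b by (simp add: power2_le_iff_abs_le)
  have "- 4 \<le> \<epsilon>" using e(1) by linarith
  then have "x\<^sup>2 \<le> 4 * (x\<^sup>2 + \<epsilon>)" using sq(2) by simp
  then have "real_of_int (x\<^sup>2) \<le> real_of_int (4 * (x\<^sup>2 + \<epsilon>))" by (simp only: of_int_le_iff)
  then have "(x / 2)\<^sup>2 \<le> X\<^sup>2" unfolding X2 by (simp add: power_divide)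
  then have Xx: "x / 2 \<le> X" using BX x by (simp add: power2_le_iff_abs_le)
  have "\<bar>X * B - y * B\<bar> \<le> 4 * c / y"
    if y: "y = real_of_int x" and c: "c = real_of_int b" for y c
  proof -
    have y0: "0 < y" and c0: "2 \<le> c" using b x y c by simp_all
    have "B * y \<le> (c + 1) * y" using Bb y0 c by (intro mult_right_mono) auto
    also have "\<dots> \<le> c * y + c * (y / 2)" using y0 c0 by (simp add: algebra_simps)
    also have "\<dots> \<le> c * y + c * X" using Xx y c0 by (intro add_left_mono mult_left_mono) auto
    finally have 4: "B * y \<le> c * (X + y)" by (simp add: algebra_simps)
    have "(\<bar>X * B - y * B\<bar> * y) * (X + y) = (\<bar>X - y\<bar> * (X + y)) * (B * y)"
    proof -
      have "X * B - y * B = (X - y) * B" by (simp add: algebra_simps)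
      then show ?thesis using BX by (simp add: abs_mult)
    qed
    also have "\<dots> \<le> (4 * c) * (X + y)" using 3 4 y by simp
    finally have "\<bar>X * B - y * B\<bar> * y \<le> 4 * c"
      by (rule mult_right_le_imp_le) (use BX y0 in simp)
    then show ?thesis using y0 by (simp add: field_simps)
  qed
  from this[OF refl refl] have "\<bar>X * B - x * B\<bar> \<le> 4 * b / x" by simp
  also have "\<dots> = 4 * b\<^sup>2 / (x * b)" using b by (simp add: power2_eq_square)
  finally show ?thesis unfolding 1 2 .
qed

text \<open>A solution beyond the threshold \<open>8192 ^ 3\<close> bounds all others; if there is
  none, the threshold is itself a bound.\<close>

theorem finite_simultaneous_pell:
  fixes D1 D2 :: int
  shows "finite {x :: int. \<exists>u v. x\<^sup>2 - 4 = D1 * u\<^sup>2 \<and> x\<^sup>2 + 4 = D2 * v\<^sup>2}" (is "finite ?S")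
proof -
  have S_abs: "\<bar>x\<bar> \<in> ?S" if "x \<in> ?S" for x using that by simp
  have S_pos: "\<exists>u v. 0 \<le> u \<and> 0 \<le> v \<and> x\<^sup>2 - 4 = D1 * u\<^sup>2 \<and> x\<^sup>2 + 4 = D2 * v\<^sup>2" if "x \<in> ?S" for x
    using that by clarsimp (metis abs_ge_zero power2_abs)
  \<comment> \<open>The exponent 16 gives \<open>N ^ 8 \<le> q\<close> for
    \<open>N = b\<^sup>2\<close> and \<open>q = x * b\<close>; the bound on \<open>b\<close> gives
    \<open>8192 ^ 6 \<le> N\<close>.\<close>
  have "x < b ^ 16" if x0: "b \<in> ?S" "8192 ^ 3 \<le> b" and x: "x \<in> ?S" for b x
  proof (rule ccontr)
    assume "\<not> x < b ^ 16"
    then have xb: "b ^ 16 \<le> x" by simp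
    obtain u0 v0 where b: "0 \<le> u0" "0 \<le> v0" "b\<^sup>2 - 4 = D1 * u0\<^sup>2" "b\<^sup>2 + 4 = D2 * v0\<^sup>2"
      using S_pos[OF x0(1)] by blast
    obtain u v where x: "0 \<le> u" "0 \<le> v" "x\<^sup>2 - 4 = D1 * u\<^sup>2" "x\<^sup>2 + 4 = D2 * v\<^sup>2"
      using S_pos[OF x] by blast
    have b3: "16 \<le> b" using x0(2) by simp
    have "b ^ 1 \<le> b ^ 16" by (rule power_increasing) (use b3 in auto)
    then have x3: "16 \<le> x" using xb b3 by simp
    have "b ^ 16 * 1 \<le> x * b" using xb b3 x3 by (intro mult_mono) auto
    then have "(b\<^sup>2) ^ 8 \<le> x * b" by (simp flip: power_mult)
    moreover have "8192 ^ 6 \<le> b\<^sup>2" using power_mono[OF x0(2), of 2] by simp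
    ultimately show False
      using pell_approximation[OF b3 x3 b(1) x(1), of "- 4" D1]
        pell_approximation[OF b3 x3 b(2) x(2), of 4 D2] b x
      by (intro no_simultaneous_approximation[of "b\<^sup>2" "x * b" "D1 * u * u0" "D2 * v * v0"]) simp_all
  qed
  note bound = this
  show ?thesis
  proof (cases "\<exists>b\<in>?S. 8192 ^ 3 \<le> b")
    case True
    then obtain b where b: "b \<in> ?S" "8192 ^ 3 \<le> b" by blast
    have "?S \<subseteq> {- (b ^ 16)..b ^ 16}"
    proof
      fix x assume "x \<in> ?S"
      then have "\<bar>x\<bar> < b ^ 16" by (intro bound[OF b] S_abs)
      then show "x \<in> {- (b ^ 16)..b ^ 16}" by auto
    qed
    then show ?thesis by (rule finite_subset) simp
  next
    case False
    have "?S \<subseteq> {- (8192 ^ 3)..8192 ^ 3}"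
    proof
      fix x assume "x \<in> ?S"
      then have "\<bar>x\<bar> < 8192 ^ 3" using S_abs[of x] False by (meson not_le)
      then show "x \<in> {- (8192 ^ 3)..8192 ^ 3}" by auto
    qed
    then show ?thesis by (rule finite_subset) simp
  qed
qed

section \<open>Lucas sequences\<close>

definition hyperbolic :: "int \<Rightarrow> int \<Rightarrow> bool" where
  "hyperbolic P Q \<longleftrightarrow> 0 < P \<and> \<bar>Q\<bar> = 1 \<and> \<not> degenerate P Q"

definition lucas_root :: "int \<Rightarrow> int \<Rightarrow> real" where
  "lucas_root P Q = (P + sqrt (lucas_disc P Q)) / 2"

lemma hyperbolic_cases:
  assumes "hyperbolic P Q"
  shows "Q = 1 \<and> 3 \<le> P \<or> Q = - 1 \<and> 1 \<le> P"
proof -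
  have "Q = 1 \<or> Q = - 1" using assms by (auto simp: hyperbolic_def)
  moreover have "3 \<le> P" if "Q = 1"
  proof -
    have "P \<noteq> 1" "P \<noteq> 2" "0 < P" using assms that by (auto simp: hyperbolic_def degenerate_def)
    then show ?thesis by linarith
  qed
  ultimately show ?thesis using assms by (auto simp: hyperbolic_def)
qed

lemma unit_power_cases: "\<bar>Q\<bar> = 1 \<Longrightarrow> Q ^ n = 1 \<or> Q ^ n = - 1" for Q :: int
  by (metis abs_1 abs_eq_iff power_abs power_one)

lemma hyperbolic_unit_power: "hyperbolic P Q \<Longrightarrow> Q ^ n = 1 \<or> Q ^ n = - 1"
  by (rule unit_power_cases) (simp add: hyperbolic_def)

lemma lucas_disc_pos:
  assumes "hyperbolic P Q"
  shows "5 \<le> lucas_disc P Q"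
  using hyperbolic_cases[OF assms] power_mono[of 3 P 2] power_mono[of 1 P 2]
  by (auto simp: lucas_disc_def)

lemma lucas_root_gt_1:
  assumes "hyperbolic P Q"
  shows "1 < lucas_root P Q"
proof -
  have "5 \<le> real_of_int (lucas_disc P Q)" using lucas_disc_pos[OF assms] by simp
  then have "sqrt 4 < sqrt (lucas_disc P Q)" by (intro real_sqrt_less_mono) simp
  moreover have "1 \<le> real_of_int P" using assms by (simp add: hyperbolic_def)
  ultimately show ?thesis by (simp add: lucas_root_def)
qed

lemma lucas_root_conjugate:
  assumes "hyperbolic P Q"
  shows "Q / lucas_root P Q = (P - sqrt (lucas_disc P Q)) / 2"
proof -
  have "0 \<le> real_of_int (lucas_disc P Q)" using lucas_disc_pos[OF assms] by simp
  then have "(sqrt (lucas_disc P Q))\<^sup>2 = P\<^sup>2 - 4 * Q" by (simp add: lucas_disc_def)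
  then have "lucas_root P Q * ((P - sqrt (lucas_disc P Q)) / 2) = Q"
    by (simp add: lucas_root_def power2_eq_square algebra_simps)
  then show ?thesis using lucas_root_gt_1[OF assms] by (simp add: field_simps)
qed

lemma lucas_root_power:
  assumes "hyperbolic P Q"
  shows "lucas_root P Q ^ n = (lucasV P Q n + lucasU P Q n * sqrt (lucas_disc P Q)) / 2"
    and "(Q / lucas_root P Q) ^ n = (lucasV P Q n - lucasU P Q n * sqrt (lucas_disc P Q)) / 2"
proof -
  \<comment> \<open>One induction serves both roots: \<open>d\<close> is the square root of the
    discriminant with either sign.\<close>
  have gen: "x ^ n = (lucasV P Q n + lucasU P Q n * d) / 2"
    if "x\<^sup>2 = P * x - Q" "x = (P + d) / 2" for x d :: real and n
  proof (induction n rule: lucasV.induct[of "\<lambda>_ _ n. x ^ n = (lucasV P Q n + lucasU P Q n * d) / 2" P Q, case_names 0 1 step])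
    case (step P' Q' n)
    have "x ^ Suc (Suc n) = x\<^sup>2 * x ^ n" by (simp add: power2_eq_square)
    also have "\<dots> = P * x ^ Suc n - Q * x ^ n" unfolding that(1) by (simp add: algebra_simps)
    finally show ?case unfolding step by (simp add: field_simps)
  qed (use that in auto)
  have sum: "lucas_root P Q + Q / lucas_root P Q = P" unfolding lucas_root_conjugate[OF assms] by (simp add: lucas_root_def field_simps)
  have ne: "lucas_root P Q \<noteq> 0" using lucas_root_gt_1[OF assms] by simp
  let ?x = "lucas_root P Q" let ?y = "Q / ?x"
  have xy: "?x * ?y = Q" using ne by simp
  have "?x\<^sup>2 = (?x + ?y) * ?x - ?x * ?y" "?y\<^sup>2 = (?x + ?y) * ?y - ?x * ?y"
    by (simp_all add: power2_eq_square algebra_simps)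
  then have "?x\<^sup>2 = P * ?x - Q" "?y\<^sup>2 = P * ?y - Q" unfolding sum xy by simp_all
  from gen[OF this(1)] gen[OF this(2), of "- sqrt (lucas_disc P Q)"]
  show "lucas_root P Q ^ n = (lucasV P Q n + lucasU P Q n * sqrt (lucas_disc P Q)) / 2"
    and "(Q / lucas_root P Q) ^ n = (lucasV P Q n - lucasU P Q n * sqrt (lucas_disc P Q)) / 2"
    unfolding lucas_root_conjugate[OF assms] by (simp_all add: lucas_root_def)
qed

lemma lucasV_root:
  assumes "hyperbolic P Q"
  shows "real_of_int (lucasV P Q n) = lucas_root P Q ^ n + Q ^ n / lucas_root P Q ^ n"
  using lucas_root_power[OF assms, of n] by (simp add: power_divide field_simps)

text \<open>The product of \<open>lucas_root P Q ^ n\<close> and its conjugate is the norm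
  \<open>Q ^ n\<close>.\<close>

lemma lucas_pell:
  assumes "hyperbolic P Q"
  shows "(lucasV P Q n)\<^sup>2 - 4 * Q ^ n = lucas_disc P Q * (lucasU P Q n)\<^sup>2"
proof -
  define d where "d = sqrt (lucas_disc P Q)"
  have d: "d\<^sup>2 = lucas_disc P Q" unfolding d_def using lucas_disc_pos[OF assms] by simp
  have "real_of_int (Q ^ n) = lucas_root P Q ^ n * (Q / lucas_root P Q) ^ n"
    using lucas_root_gt_1[OF assms] by (simp flip: power_mult_distrib)
  also have "\<dots> = ((lucasV P Q n)\<^sup>2 - d\<^sup>2 * (lucasU P Q n)\<^sup>2) / 4"
    unfolding lucas_root_power[OF assms] d_def[symmetric] by (simp add: power2_eq_square field_simps)
  finally have "real_of_int ((lucasV P Q n)\<^sup>2 - 4 * Q ^ n) = real_of_int (lucas_disc P Q * (lucasU P Q n)\<^sup>2)"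
    unfolding d by simp
  then show ?thesis by (simp only: of_int_eq_iff)
qed

lemma lucasV_pos:
  assumes "hyperbolic P Q"
  shows "0 < lucasV P Q n"
proof (cases n)
  case (Suc k)
  have r: "1 < lucas_root P Q ^ n" using lucas_root_gt_1[OF assms] Suc by (intro one_less_power) auto
  have "real_of_int (Q ^ n) = 1 \<or> real_of_int (Q ^ n) = - 1"
    using hyperbolic_unit_power[OF assms, of n] by (metis of_int_1 of_int_minus)
  then have "\<bar>Q ^ n / lucas_root P Q ^ n\<bar> < 1"
    unfolding of_int_power using r by (auto simp: abs_divide)
  then have "0 < real_of_int (lucasV P Q n)" unfolding lucasV_root[OF assms] using r by (simp only: of_int_power)
  then show ?thesis by simp
qed simp

text \<open>The \<open>a\<close>-th powers of the two roots have sum \<open>lucasV P Q a\<close> and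
  product \<open>Q ^ a\<close>, so they are the roots belonging to a new pair.\<close>

lemma lucasV_mult:
  assumes "hyperbolic P Q"
  shows "lucasV (lucasV P Q a) (Q ^ a) j = lucasV P Q (a * j)"
proof -
  let ?x = "lucas_root P Q ^ a"
  let ?y = "Q ^ a / ?x"
  have x: "0 < ?x" using lucas_root_gt_1[OF assms] by simp
  have V: "real_of_int (lucasV P Q (a * j)) = ?x ^ j + ?y ^ j" for j
    unfolding lucasV_root[OF assms] by (simp add: power_mult power_divide)
  have rec: "(?x + ?y) * (?x ^ Suc n + ?y ^ Suc n) - Q ^ a * (?x ^ n + ?y ^ n)
      = ?x ^ Suc (Suc n) + ?y ^ Suc (Suc n)" for n
  proof -
    have "(u + v) * (u ^ Suc n + v ^ Suc n) - u * v * (u ^ n + v ^ n) = u ^ Suc (Suc n) + v ^ Suc (Suc n)"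
      for u v :: real by (simp add: algebra_simps)
    moreover have "?x * ?y = Q ^ a"
      unfolding times_divide_eq_right
      by (rule nonzero_mult_div_cancel_left) (rule less_imp_neq[OF x, symmetric])
    ultimately show ?thesis by metis
  qed
  have "real_of_int (lucasV (lucasV P Q a) (Q ^ a) j) = ?x ^ j + ?y ^ j"
  proof (induction j rule: lucasV.induct[of "\<lambda>_ _ j. real_of_int (lucasV (lucasV P Q a) (Q ^ a) j) = ?x ^ j + ?y ^ j" P Q, case_names 0 1 step])
    case (step P' Q' n)
    then show ?case using rec[of n] lucasV_root[OF assms, of a] by simp
  qed (simp_all add: lucasV_root[OF assms])
  then show ?thesis unfolding V[symmetric] by simp
qed

section \<open>Traces and norms\<close>

text \<open>The difference of the traces is \<open>(x - y) * (x * y - s) / (x * y)\<close>, and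
  \<open>x * y = s\<close> is possible only for \<open>x = y = 1\<close>.\<close>

lemma unit_trace_inj:
  fixes x y s :: real
  assumes s: "s = 1 \<or> s = - 1" and x: "1 \<le> x" and y: "1 \<le> y" and eq: "x + s / x = y + s / y"
  shows "x = y"
proof -
  have "(x - y) * (x * y - s) = (x * y) * ((x + s / x) - (y + s / y))"
    using x y by (simp add: field_simps)
  then have "x = y \<or> x * y = s" unfolding eq by simp
  moreover have "x = y" if "x * y = s"
  proof -
    have "1 * 1 \<le> x * y" using x y by (intro mult_mono) auto
    then have "x * y = 1" using s that by auto
    moreover have "x * 1 \<le> x * y" "1 * y \<le> x * y" using x y by (intro mult_left_mono mult_right_mono; simp)+
    ultimately show ?thesis using x y by simp
  qed
  ultimately show ?thesis by blast
qed

text \<open>If the norms differed, the two integral traces of the common power \<open>x > 1\<close>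
  would differ by 2 / x in absolute value. This forces \<open>x = 2\<close>, and then twice a trace
  would be odd.\<close>

lemma common_power_norm:
  assumes h1: "hyperbolic P1 Q1" and h2: "hyperbolic P2 Q2"
    and eq: "lucas_root P1 Q1 ^ n = lucas_root P2 Q2 ^ m"
  shows "Q1 ^ n = Q2 ^ m"
proof (rule ccontr)
  assume ne: "Q1 ^ n \<noteq> Q2 ^ m"
  define x where "x = lucas_root P1 Q1 ^ n"
  have x2: "x = lucas_root P2 Q2 ^ m" using eq x_def by simp
  have "n \<noteq> 0"
  proof
    assume "n = 0"
    with eq lucas_root_gt_1[OF h2] have "m = 0" by (metis one_less_power power_0 gr0I less_irrefl)
    with \<open>n = 0\<close> ne show False by simp
  qed
  then have x1: "1 < x" unfolding x_def using lucas_root_gt_1[OF h1] by (intro one_less_power) auto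
  have V: "real_of_int (lucasV P1 Q1 n) = x + Q1 ^ n / x" "real_of_int (lucasV P2 Q2 m) = x + Q2 ^ m / x"
    using lucasV_root[OF h1, of n] lucasV_root[OF h2, of m] by (simp_all add: x_def[symmetric] x2[symmetric])
  define e where "e = lucasV P1 Q1 n - lucasV P2 Q2 m"
  have e: "real_of_int e * x = Q1 ^ n - Q2 ^ m" unfolding e_def using V x1 by (simp add: field_simps)
  have "Q1 ^ n - Q2 ^ m = 2 \<or> Q1 ^ n - Q2 ^ m = - 2"
    using hyperbolic_unit_power[OF h1, of n] hyperbolic_unit_power[OF h2, of m] ne by auto
  then have ex: "real_of_int e * x = 2 \<or> real_of_int e * x = - 2"
    unfolding e by (metis of_int_diff of_int_minus of_int_numeral of_int_power)
  then have "\<bar>real_of_int e * x\<bar> = 2" by auto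
  then have ax: "real_of_int \<bar>e\<bar> * x = 2" using x1 by (simp add: abs_mult)
  then have "\<bar>e\<bar> \<noteq> 0" by auto
  moreover have "\<bar>e\<bar> < 2"
  proof (rule ccontr)
    assume "\<not> \<bar>e\<bar> < 2"
    then have "2 * x \<le> real_of_int \<bar>e\<bar> * x" using x1 by (intro mult_right_mono) auto
    with ax x1 show False by simp
  qed
  ultimately have "\<bar>e\<bar> = 1" by linarith
  with ax have "x = 2" by simp
  then have "real_of_int (2 * lucasV P1 Q1 n) = real_of_int (4 + Q1 ^ n)" using V(1) by simp
  then have "2 * lucasV P1 Q1 n = 4 + Q1 ^ n" by (simp only: of_int_eq_iff)
  then show False using hyperbolic_unit_power[OF h1, of n] by presburger
qed

lemma lucas_pell_unit:
  assumes "hyperbolic P Q"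
  shows "lucasV P Q n ^ 2 - 4 = lucas_disc P Q * lucasU P Q n ^ 2 \<and> Q ^ n = 1
       \<or> lucasV P Q n ^ 2 + 4 = lucas_disc P Q * lucasU P Q n ^ 2 \<and> Q ^ n = - 1"
  using lucas_pell[OF assms, of n] hyperbolic_unit_power[OF assms, of n] by auto

lemma square_of_square_ratio:
  fixes D b c :: int
  assumes "D * b\<^sup>2 = c\<^sup>2" "b \<noteq> 0"
  shows "\<exists>k. D = k\<^sup>2"
proof -
  have "b\<^sup>2 dvd c\<^sup>2" using assms(1) by (metis dvd_triv_right)
  then obtain d where "c = b * d" by (auto simp: pow_divides_pow_iff elim: dvdE)
  then have "D * b\<^sup>2 = d\<^sup>2 * b\<^sup>2" using assms(1) by (simp add: power_mult_distrib)
  then have "D = d\<^sup>2" using assms(2) by simp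
  then show ?thesis by blast
qed

text \<open>For \<open>3 \<le> t\<close> the number \<open>t ^ 4 - 16\<close> lies strictly between
  the squares of \<open>t\<^sup>2 - 1\<close> and \<open>t\<^sup>2\<close>.\<close>

lemma fourth_power_minus_16_square:
  fixes t w :: int
  assumes t: "0 < t" and eq: "t ^ 4 - 16 = w\<^sup>2"
  shows "t = 2"
proof (rule ccontr)
  assume "t \<noteq> 2"
  moreover have "0 \<le> t ^ 4 - 16" unfolding eq by simp
  then have "t \<noteq> 1" by auto
  ultimately have "3 \<le> t" using t by linarith
  then have t2: "9 \<le> t\<^sup>2" using power_mono[of 3 t 2] by simp
  have t4: "t ^ 4 = (t\<^sup>2)\<^sup>2" by (simp flip: power_mult)
  have "(t\<^sup>2 - 1)\<^sup>2 = (t\<^sup>2)\<^sup>2 - 2 * t\<^sup>2 + 1" by (simp add: power2_diff)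
  then have "(t\<^sup>2 - 1)\<^sup>2 < \<bar>w\<bar>\<^sup>2" unfolding power2_abs using eq t2 t4 by linarith
  then have "t\<^sup>2 - 1 < \<bar>w\<bar>" by (rule power_less_imp_less_base) simp
  moreover have "\<bar>w\<bar>\<^sup>2 < (t\<^sup>2)\<^sup>2" unfolding power2_abs using eq t4 by linarith
  then have "\<bar>w\<bar> < t\<^sup>2" by (rule power_less_imp_less_base) simp
  ultimately show False by linarith
qed

section \<open>Infinite intersection forces a square\<close>

lemma infinite_intersection_imp_square:
  assumes h1: "hyperbolic P1 Q1" and h2: "hyperbolic P2 Q2"
    and inf: "infinite (Vset P1 Q1 \<inter> Vset P2 Q2)"
  shows "\<exists>k. lucas_disc P1 Q1 * lucas_disc P2 Q2 = k\<^sup>2"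
proof (rule ccontr)
  let ?D1 = "lucas_disc P1 Q1" and ?D2 = "lucas_disc P2 Q2"
  assume nsq: "\<nexists>k. ?D1 * ?D2 = k\<^sup>2"
  have same: False if "t\<^sup>2 - e = ?D1 * u\<^sup>2" "t\<^sup>2 - e = ?D2 * v\<^sup>2" "t\<^sup>2 \<noteq> e" for t e u v
  proof -
    have "(?D1 * ?D2) * (u * v)\<^sup>2 = (?D1 * u\<^sup>2) * (?D2 * v\<^sup>2)" by (simp add: power_mult_distrib)
    also have "\<dots> = (t\<^sup>2 - e)\<^sup>2" unfolding that(1,2)[symmetric] by (simp add: power2_eq_square)
    finally show False using square_of_square_ratio[of "?D1 * ?D2" "u * v"] nsq that by fastforce
  qed
  let ?S = "\<lambda>D1 D2. {x :: int. \<exists>u v. x\<^sup>2 - 4 = D1 * u\<^sup>2 \<and> x\<^sup>2 + 4 = D2 * v\<^sup>2}"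
  \<comment> \<open>For \<open>t > 2\<close> neither \<open>t\<^sup>2 - 4\<close> nor
    \<open>t\<^sup>2 + 4\<close> is 0, so equal norms are excluded by \<open>same\<close> and only
    the simultaneous Pell equations remain.\<close>
  have "Vset P1 Q1 \<inter> Vset P2 Q2 \<subseteq> {1, 2} \<union> ?S ?D1 ?D2 \<union> ?S ?D2 ?D1"
  proof
    fix t assume "t \<in> Vset P1 Q1 \<inter> Vset P2 Q2"
    then obtain n m where n: "t = lucasV P1 Q1 n" and m: "t = lucasV P2 Q2 m" unfolding Vset_def by blast
    have t0: "0 < t" unfolding n by (rule lucasV_pos[OF h1])
    show "t \<in> {1, 2} \<union> ?S ?D1 ?D2 \<union> ?S ?D2 ?D1"
    proof (cases "t \<le> 2")
      case True
      then show ?thesis using t0 by auto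
    next
      case False
      then have "3\<^sup>2 \<le> t\<^sup>2" by (intro power_mono) auto
      then have ne: "t\<^sup>2 \<noteq> 4" "t\<^sup>2 \<noteq> - 4" by auto
      show ?thesis
        using lucas_pell_unit[OF h1, of n, folded n] lucas_pell_unit[OF h2, of m, folded m]
          same[of t 4] same[of t "- 4", unfolded diff_minus_eq_add] ne by blast
    qed
  qed
  moreover have "finite ({1, 2} \<union> ?S ?D1 ?D2 \<union> ?S ?D2 ?D1)"
    using finite_simultaneous_pell[of ?D1 ?D2] finite_simultaneous_pell[of ?D2 ?D1] by simp
  ultimately show False using inf finite_subset by blast
qed

section \<open>A square forces common powers\<close>

lemma finite_bounded_half_integer_trace:
  "finite {x :: real. 1 \<le> x \<and> (\<exists>s\<in>{1, - 1}. \<exists>j :: int. 2 * (x + s / x) = j \<and> \<bar>j\<bar> \<le> B)}"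
proof -
  have "finite {x :: real. 1 \<le> x \<and> 2 * (x + s / x) = real_of_int j}" (is "finite ?X")
    if "s \<in> {1, - 1}" for s and j :: int
  proof -
    have "x = y" if "x \<in> ?X" "y \<in> ?X" for x y
    proof (rule unit_trace_inj[of s])
      show "x + s / x = y + s / y" using that by simp
    qed (use that \<open>s \<in> {1, - 1}\<close> in auto)
    then have "?X \<subseteq> {z}" if "z \<in> ?X" for z using that by blast
    then show ?thesis by (cases "?X = {}") (auto intro: finite_subset)
  qed
  then have "finite (\<Union>s\<in>{1, - 1}. \<Union>j\<in>{- B..B}. {x :: real. 1 \<le> x \<and> 2 * (x + s / x) = real_of_int j})"
    by blast
  then show ?thesis by (rule rev_finite_subset) (auto simp: abs_le_iff)
qed

text \<open>Divide \<open>x ^ n\<close> by the largest power of \<open>y\<close> not exceeding it.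
  The quotient lies between 1 and \<open>y\<close>, has norm 1 or -1 and a half-integral bounded
  trace, so it takes finitely many values. Two equal quotients yield the relation.\<close>

lemma common_power_exists:
  assumes h1: "hyperbolic P1 Q1" and h2: "hyperbolic P2 Q2"
    and k: "lucas_disc P1 Q1 * lucas_disc P2 Q2 = k\<^sup>2"
  shows "\<exists>a b. 0 < a \<and> lucas_root P1 Q1 ^ a = lucas_root P2 Q2 ^ b"
proof -
  define x where "x = lucas_root P1 Q1"
  define y where "y = lucas_root P2 Q2"
  have x1: "1 < x" and y1: "1 < y" using lucas_root_gt_1 h1 h2 by (simp_all add: x_def y_def)
  have ex: "\<exists>m. y ^ m \<le> x ^ n \<and> x ^ n < y ^ Suc m" for n
  proof -
    have e: "\<exists>m. x ^ n < y ^ m" using real_arch_pow[OF y1] by blast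
    define m where "m = (LEAST m. x ^ n < y ^ m)"
    have m: "x ^ n < y ^ m" unfolding m_def by (rule LeastI_ex[OF e])
    have "1 \<le> x ^ n" using x1 by (intro one_le_power) simp
    then have "m \<noteq> 0" using m by (metis power_0 not_le)
    then obtain m' where m': "m = Suc m'" by (cases m) auto
    have "\<not> x ^ n < y ^ m'" by (rule not_less_Least) (simp add: m' flip: m_def)
    then show ?thesis using m m' by (intro exI[of _ m']) simp
  qed
  define \<mu> where "\<mu> n = (SOME m. y ^ m \<le> x ^ n \<and> x ^ n < y ^ Suc m)" for n
  have \<mu>: "y ^ \<mu> n \<le> x ^ n" "x ^ n < y ^ Suc (\<mu> n)" for n
    using someI_ex[OF ex[of n]] by (simp_all add: \<mu>_def)
  define \<beta> where "\<beta> n = x ^ n / y ^ \<mu> n" for n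
  have \<beta>1: "1 \<le> \<beta> n" "\<beta> n < y" for n using \<mu>[of n] y1 by (simp_all add: \<beta>_def field_simps)
  define F where "F = {z :: real. 1 \<le> z \<and> (\<exists>s\<in>{1, - 1}. \<exists>j :: int. 2 * (z + s / z) = j \<and> \<bar>j\<bar> \<le> \<lceil>2 * (y + 1)\<rceil>)}"
  have "\<beta> n \<in> F" for n
  proof -
    let ?m = "\<mu> n"
    define d1 d2 where "d1 = sqrt (lucas_disc P1 Q1)" and "d2 = sqrt (lucas_disc P2 Q2)"
    define X Y :: real where "X = x ^ n" and "Y = y ^ ?m"
    define V U W Z :: int where "V = lucasV P1 Q1 n" and "U = lucasU P1 Q1 n"
      and "W = lucasV P2 Q2 ?m" and "Z = lucasU P2 Q2 ?m"
    define q1 q2 :: int where "q1 = Q1 ^ n" and "q2 = Q2 ^ ?m"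
    have q: "q1 = 1 \<or> q1 = - 1" "q2 = 1 \<or> q2 = - 1"
      using hyperbolic_unit_power h1 h2 by (auto simp: q1_def q2_def)
    have pos: "0 < X" "0 < Y" using x1 y1 by (simp_all add: X_def Y_def)
    have X: "X = (V + U * d1) / 2" "q1 / X = (V - U * d1) / 2"
      using lucas_root_power[OF h1, of n] by (simp_all add: X_def x_def V_def U_def d1_def q1_def power_divide)
    have Y: "Y = (W + Z * d2) / 2" "q2 / Y = (W - Z * d2) / 2"
      using lucas_root_power[OF h2, of ?m] by (simp_all add: Y_def y_def W_def Z_def d2_def q2_def power_divide)
    have "d1 * d2 = \<bar>k\<bar>"
      unfolding d1_def d2_def real_sqrt_mult[symmetric] of_int_mult[symmetric] k by simp
    define s where "s = real_of_int (q1 * q2)"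
    have s: "s \<in> {1, - 1}" using q by (auto simp: s_def)
    \<comment> \<open>Since \<open>q2 / Y\<close> is the conjugate of \<open>Y\<close>, this is the
      trace of \<open>X / Y\<close> in terms of conjugates. The irrational parts cancel except for
      \<open>d1 * d2\<close>, which is the integer \<open>\<bar>k\<bar>\<close>.\<close>
    have "2 * (\<beta> n + s / \<beta> n) = 2 * q2 * (X * (q2 / Y) + (q1 / X) * Y)"
      using q pos by (auto simp: \<beta>_def s_def X_def[symmetric] Y_def[symmetric] field_simps)
    also have "\<dots> = q2 * (V * W - U * Z * (d1 * d2))"
      unfolding X(2) Y(2) unfolding X(1) Y(1) by (simp add: field_simps)
    finally have j: "2 * (\<beta> n + s / \<beta> n) = real_of_int (q2 * (V * W - U * Z * \<bar>k\<bar>))"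
      unfolding \<open>d1 * d2 = \<bar>k\<bar>\<close> by simp
    have "\<bar>s / \<beta> n\<bar> \<le> 1" using s \<beta>1[of n] by (auto simp: abs_divide)
    moreover have "\<bar>2 * (z + c)\<bar> \<le> 2 * (y + 1)" if "\<bar>c\<bar> \<le> 1" "1 \<le> z" "z < y" for z c :: real
      using that by (simp add: abs_le_iff)
    ultimately have "\<bar>2 * (\<beta> n + s / \<beta> n)\<bar> \<le> 2 * (y + 1)" using \<beta>1[of n] by blast
    then have "\<bar>q2 * (V * W - U * Z * \<bar>k\<bar>)\<bar> \<le> \<lceil>2 * (y + 1)\<rceil>" unfolding j by linarith
    then show ?thesis unfolding F_def using \<beta>1(1) s j by blast
  qed
  then have "range \<beta> \<subseteq> F" by blast
  then have "finite (range \<beta>)"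
    by (rule finite_subset) (simp only: F_def finite_bounded_half_integer_trace)
  then have "\<not> inj \<beta>" using finite_imageD by blast
  then obtain n n' where "n < n'" "\<beta> n = \<beta> n'" by (metis injI linorder_neqE_nat)
  then have eq: "x ^ n' * y ^ \<mu> n = x ^ n * y ^ \<mu> n'" using y1 by (simp add: \<beta>_def field_simps)
  define a where "a = n' - n"
  have a: "n' = n + a" "0 < a" using \<open>n < n'\<close> by (simp_all add: a_def)
  have eq: "x ^ a * y ^ \<mu> n = y ^ \<mu> n'" using eq x1 by (simp add: a power_add)
  moreover have "1 \<le> x ^ a" using x1 by (intro one_le_power) simp
  \<comment> \<open>Monotonicity makes the exponent \<open>\<mu> n' - \<mu> n\<close> a natural
    number.\<close>
  ultimately have "y ^ \<mu> n \<le> y ^ \<mu> n'" using y1 by (metis mult_right_mono mult_1 zero_le_power less_imp_le zero_less_one order_trans)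
  then have "\<mu> n \<le> \<mu> n'" using y1 by (simp add: power_increasing_iff)
  then obtain b where "\<mu> n' = \<mu> n + b" using le_Suc_ex by blast
  then have "x ^ a = y ^ b" using eq y1 by (simp add: power_add)
  then show ?thesis using a(2) unfolding x_def y_def by blast
qed

text \<open>Each term differs from the corresponding power of \<open>?x > 1\<close> by at most 1, so
  the terms are unbounded.\<close>

lemma infinite_Vset_multiples:
  assumes h: "hyperbolic P Q" and a: "0 < a"
  shows "infinite (range (\<lambda>j. lucasV P Q (a * j)))"
proof
  let ?x = "lucas_root P Q ^ a"
  assume "finite (range (\<lambda>j. lucasV P Q (a * j)))"
  then obtain B where B: "lucasV P Q (a * j) \<le> B" for j
    by (metis Max_ge rangeI)
  have x: "1 < ?x" using lucas_root_gt_1[OF h] a by (intro one_less_power) auto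
  then obtain j where j: "B + 1 < ?x ^ j" using real_arch_pow by blast
  have 1: "1 \<le> ?x ^ j" by (rule one_le_power) (rule less_imp_le[OF x])
  have "real_of_int (Q ^ (a * j)) = 1 \<or> real_of_int (Q ^ (a * j)) = - 1"
    using hyperbolic_unit_power[OF h, of "a * j"] by (metis of_int_1 of_int_minus)
  then have "\<bar>real_of_int (Q ^ (a * j)) / ?x ^ j\<bar> \<le> 1" using 1 by (auto simp: abs_divide)
  then have "?x ^ j - 1 \<le> lucasV P Q (a * j)" unfolding lucasV_root[OF h] of_int_power power_mult by linarith
  moreover have "real_of_int (lucasV P Q (a * j)) \<le> B" using B by simp
  ultimately show False using j by linarith
qed

lemma square_imp_intersection:
  assumes h1: "hyperbolic P1 Q1" and h2: "hyperbolic P2 Q2"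
    and k: "lucas_disc P1 Q1 * lucas_disc P2 Q2 = k\<^sup>2"
  shows "\<exists>a>0. Vset P1 Q1 \<inter> Vset P2 Q2 = range (\<lambda>j. lucasV P1 Q1 (a * j))"
proof -
  define x where "x = lucas_root P1 Q1"
  define y where "y = lucas_root P2 Q2"
  have x1: "1 < x" and y1: "1 < y" using lucas_root_gt_1 h1 h2 by (simp_all add: x_def y_def)
  have ex: "\<exists>a. 0 < a \<and> (\<exists>b. x ^ a = y ^ b)"
    using common_power_exists[OF h1 h2 k] by (simp add: x_def y_def)
  define a where "a = (LEAST a. 0 < a \<and> (\<exists>b. x ^ a = y ^ b))"
  have "0 < a \<and> (\<exists>b. x ^ a = y ^ b)" unfolding a_def by (rule LeastI_ex[OF ex])
  then obtain b where a: "0 < a" and ab: "x ^ a = y ^ b" by blast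
  \<comment> \<open>Dividing \<open>n\<close> by \<open>a\<close>, the remainder is again an
    exponent of a common power, so it is 0 by minimality of \<open>a\<close>.\<close>
  have dvd: "a dvd n" if nm: "x ^ n = y ^ m" for n m
  proof -
    let ?r = "n mod a" and ?q = "n div a"
    have "y ^ m = x ^ ?r * x ^ (a * ?q)" unfolding nm[symmetric] by (simp flip: power_add)
    also have "\<dots> = x ^ ?r * y ^ (b * ?q)" unfolding power_mult ab ..
    finally have eq: "y ^ m = x ^ ?r * y ^ (b * ?q)" .
    have "1 * y ^ (b * ?q) \<le> x ^ ?r * y ^ (b * ?q)"
      using x1 y1 by (intro mult_right_mono one_le_power) auto
    then have "b * ?q \<le> m" unfolding eq[symmetric] using y1 by (simp add: power_increasing_iff)
    then obtain c where c: "m = b * ?q + c" using le_Suc_ex by blast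
    have "x ^ ?r = y ^ c" using eq y1 by (simp add: c power_add)
    moreover have "?r < a" using a by simp
    ultimately have "?r = 0" using not_less_Least[of ?r "\<lambda>a. 0 < a \<and> (\<exists>b. x ^ a = y ^ b)"]
      unfolding a_def[symmetric] by (metis gr0I)
    then show ?thesis by auto
  qed
  have "Vset P1 Q1 \<inter> Vset P2 Q2 = range (\<lambda>j. lucasV P1 Q1 (a * j))"
  proof (intro equalityI subsetI)
    fix t assume "t \<in> range (\<lambda>j. lucasV P1 Q1 (a * j))"
    then obtain j where t: "t = lucasV P1 Q1 (a * j)" by blast
    have eq: "lucas_root P1 Q1 ^ (a * j) = lucas_root P2 Q2 ^ (b * j)"
      using ab by (simp add: x_def y_def power_mult)
    have "real_of_int (lucasV P1 Q1 (a * j)) = real_of_int (lucasV P2 Q2 (b * j))"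
      using lucasV_root[OF h1, of "a * j"] lucasV_root[OF h2, of "b * j"] eq common_power_norm[OF h1 h2 eq]
      by (metis of_int_power)
    then have "lucasV P1 Q1 (a * j) = lucasV P2 Q2 (b * j)" by (simp only: of_int_eq_iff)
    then show "t \<in> Vset P1 Q1 \<inter> Vset P2 Q2" unfolding t Vset_def by (metis IntI rangeI)
  next
    fix t assume "t \<in> Vset P1 Q1 \<inter> Vset P2 Q2"
    then obtain n m where n: "t = lucasV P1 Q1 n" and m: "t = lucasV P2 Q2 m" unfolding Vset_def by blast
    have t0: "0 < t" unfolding n by (rule lucasV_pos[OF h1])
    show "t \<in> range (\<lambda>j. lucasV P1 Q1 (a * j))"
    proof (cases "Q1 ^ n = Q2 ^ m")
      case True
      have "x ^ n = y ^ m"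
      proof (rule unit_trace_inj[of "real_of_int (Q1 ^ n)"])
        show "real_of_int (Q1 ^ n) = 1 \<or> real_of_int (Q1 ^ n) = - 1"
          using hyperbolic_unit_power[OF h1, of n] by (metis of_int_1 of_int_minus)
        show "x ^ n + (Q1 ^ n) / x ^ n = y ^ m + (Q1 ^ n) / y ^ m"
          using lucasV_root[OF h1, of n, folded n] lucasV_root[OF h2, of m, folded m] True
          unfolding x_def y_def by (metis of_int_power)
      qed (use x1 y1 in \<open>simp_all add: one_le_power\<close>)
      from dvd[OF this] obtain j where "n = a * j" by (elim dvdE)
      then show ?thesis using n by blast
    next
      case False
      let ?u = "lucasU P1 Q1 n" and ?v = "lucasU P2 Q2 m"
      \<comment> \<open>With opposite norms the product of the two Pell relations makes
        \<open>t ^ 4 - 16\<close> a square. Hence \<open>t = 2\<close>, the term of index 0.\<close>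
      have "(t\<^sup>2 - 4) * (t\<^sup>2 + 4) = (lucas_disc P1 Q1 * ?u\<^sup>2) * (lucas_disc P2 Q2 * ?v\<^sup>2)"
        using lucas_pell_unit[OF h1, of n, folded n] lucas_pell_unit[OF h2, of m, folded m] False
        by (auto simp: mult.commute)
      also have "\<dots> = (lucas_disc P1 Q1 * lucas_disc P2 Q2) * (?u * ?v)\<^sup>2"
        by (simp add: power_mult_distrib)
      finally have "t ^ 4 - 16 = (k * ?u * ?v)\<^sup>2"
        unfolding k by (simp add: algebra_simps power_mult_distrib eval_nat_numeral)
      then have "t = lucasV P1 Q1 (a * 0)" using fourth_power_minus_16_square[OF t0] by simp
      then show ?thesis by blast
    qed
  qed
  then show ?thesis using a by blast
qed

theorem theorem8:
  fixes P1 Q1 P2 Q2 :: int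
  assumes "(P1, Q1) \<noteq> (P2, Q2)"
    and "\<not> degenerate P1 Q1" and "\<not> degenerate P2 Q2"
    and "P1 > 0" and "P2 > 0"
    and "\<bar>Q1\<bar> = 1" and "\<bar>Q2\<bar> = 1"
  shows "(infinite (Vset P1 Q1 \<inter> Vset P2 Q2) \<longleftrightarrow>
           (\<exists>k::int. lucas_disc P1 Q1 * lucas_disc P2 Q2 = k^2))
       \<and> (infinite (Vset P1 Q1 \<inter> Vset P2 Q2) \<longrightarrow>
           (\<exists>P' Q' :: int. P' > 0 \<and> \<bar>Q'\<bar> = 1 \<and>
              Vset P1 Q1 \<inter> Vset P2 Q2 = Vset P' Q'))"
proof -
  have h1: "hyperbolic P1 Q1" and h2: "hyperbolic P2 Q2" using assms by (simp_all add: hyperbolic_def)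
  note forward = infinite_intersection_imp_square[OF h1 h2]
  have backward: "infinite (Vset P1 Q1 \<inter> Vset P2 Q2) \<and>
      (\<exists>P' Q' :: int. P' > 0 \<and> \<bar>Q'\<bar> = 1 \<and> Vset P1 Q1 \<inter> Vset P2 Q2 = Vset P' Q')"
    if k: "\<exists>k. lucas_disc P1 Q1 * lucas_disc P2 Q2 = k\<^sup>2"
  proof -
    obtain a where a: "0 < a" and eq: "Vset P1 Q1 \<inter> Vset P2 Q2 = range (\<lambda>j. lucasV P1 Q1 (a * j))"
      using k square_imp_intersection[OF h1 h2] by blast
    \<comment> \<open>The witnesses are the trace \<open>lucasV P1 Q1 a\<close> and the norm
      \<open>Q1 ^ a\<close> of the least common power.\<close>
    have "range (\<lambda>j. lucasV P1 Q1 (a * j)) = Vset (lucasV P1 Q1 a) (Q1 ^ a)"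
      unfolding Vset_def lucasV_mult[OF h1, symmetric] ..
    moreover have "\<bar>Q1 ^ a\<bar> = 1" using assms by (simp add: power_abs)
    moreover have "0 < lucasV P1 Q1 a" by (rule lucasV_pos[OF h1])
    ultimately show ?thesis using infinite_Vset_multiples[OF h1 a] unfolding eq by metis
  qed
  show ?thesis using forward backward by blast
qed

end
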